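(* Let $\pi$ be an abelian group and $(H,\triangleright)$ a cocommutative post-Hopf $\pi$-algebra, with $H=(\{H_\alpha\}_{\alpha\in\pi},\cdot,1,\Delta,\varepsilon,S)$. Define $$x*_{\alpha,\beta}y:=x_{(1,\alpha)}\cdot(x_{(2,\alpha)}\triangleright_{\alpha,\beta}y),\qquad T_\alpha(x):=\psi_{\alpha,\bar\alpha,x_{(1,\alpha)}}(S_\alpha(x_{(2,\alpha)})),$$ for all $x\in H_\alpha$, $y\in H_\beta$, $\alpha,\beta\in\pi$. Then $H_\triangleright:=(H,*,1,\Delta,\varepsilon,T)$ is a Hopf $\pi$-algebra. Furthermore, $(H_e,\cdot,1,\Delta_e,\varepsilon_e,S_e)$ is a left $\pi$-$H_\triangleright$-modulelike bialgebra under the action $\{\triangleright_{\alpha,e}\}_{\alpha\in\pi}$.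
   Context: All spaces and tensor products are over a base field $\Bbbk$. Let $\pi$ be an abelian group with unit $e$; write $\bar\alpha=\alpha^{-1}$. A Hopf $\pi$-algebra is a family $H=\{H_\alpha\}_{\alpha\in\pi}$ of coalgebras $(H_\alpha,\Delta_\alpha,\varepsilon_\alpha)$ with linear maps $m_{\alpha,\beta}:H_\alpha\otimes H_\beta\to H_{\alpha\beta}$ (the multiplication) and $\eta:\Bbbk\to H_e$ (the unit, $1=\eta(1)\in H_e$) that are coalgebra maps, associative and unital in the graded sense, and with an antipode, a family of linear maps $S_\alpha:H_\alpha\to H_{\bar\alpha}$ with $S_\alpha(h_{(1,\alpha)})h_{(2,\alpha)}=\varepsilon_\alpha(h)1=h_{(1,\alpha)}S_\alpha(h_{(2,\alpha)})$. Here $\Delta_\alpha(h)=h_{(1,\alpha)}\otimes h_{(2,\alpha)}$ is Sweedler notation. $H$ is cocommutative if every $H_\alpha$ is cocommutative. A post-Hopf $\pi$-algebra is a pair $(H,\triangleright)$ where $H=(\{H_\alpha\}_{\alpha\in\pi},\cdot,1,\Delta,\varepsilon,S)$ is a Hopf $\pi$-algebra and $\triangleright=\{\triangleright_{\alpha,\beta}:H_\alpha\otimes H_\beta\to H_\beta\}$ is a family of coalgebra homomorphisms such that for all $x\in H_\alpha,y\in H_\beta,z\in H_\gamma$: $x\triangleright_{\alpha,\beta\gamma}(yz)=(x_{(1,\alpha)}\triangleright_{\alpha,\beta}y)(x_{(2,\alpha)}\triangleright_{\alpha,\gamma}z)$ and $x\triangleright_{\alpha,\gamma}(y\triangleright_{\beta,\gamma}z)=(x_{(1,\alpha)}(x_{(2,\alpha)}\triangleright_{\alpha,\beta}y))\triangleright_{\alpha\beta,\gamma}z$;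 and such that the map $\theta_{\alpha,\beta}:H_\alpha\to\mathrm{End}(H_\beta)$, $\theta_{\alpha,\beta,x}(y)=x\triangleright_{\alpha,\beta}y$, is convolution invertible in $\mathrm{Hom}(H_\alpha,\mathrm{End}(H_\beta))$, i.e. there is a unique $\psi_{\alpha,\beta}:H_\alpha\to\mathrm{End}(H_\beta)$, $x\mapsto\psi_{\alpha,\beta,x}$, with $\psi_{\alpha,\beta,x_{(1,\alpha)}}\theta_{\alpha,\beta,x_{(2,\alpha)}}=\theta_{\alpha,\beta,x_{(1,\alpha)}}\psi_{\alpha,\beta,x_{(2,\alpha)}}=\varepsilon_\alpha(x)\mathrm{id}_{H_\beta}$. It is cocommutative if each $H_\alpha$ is cocommutative. For a Hopf $\pi$-algebra $K=\{K_\alpha\}$ and an ordinary Hopf algebra $A$, $A$ is a left $\pi$-$K$-modulelike bialgebra under linear maps $\rightharpoonup_\alpha:K_\alpha\otimes A\to A$ if for all $k\in K_\alpha$, $\ell\in K_\beta$, $a,b\in A$: $(k\ell)\rightharpoonup_{\alpha\beta}a=k\rightharpoonup_\alpha(\ell\rightharpoonup_\beta a)$; $1_e\rightharpoonup_e a=a$; $k\rightharpoonup_\alpha(ab)=(k_{(1,\alpha)}\rightharpoonup_\alpha a)(k_{(2,\alpha)}\rightharpoonup_\alpha b)$; $k\rightharpoonup_\alpha 1_A=\varepsilon_\alpha(k)1_A$; $\Delta_A(k\rightharpoonup_\alpha a)=(k_{(1,\alpha)}\rightharpoonup_\alpha a_{(1)})\otimes(k_{(2,\alpha)}\rightharpoonup_\alpha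 a_{(2)})$; $\varepsilon_A(k\rightharpoonup_\alpha a)=\varepsilon_\alpha(k)\varepsilon_A(a)$. *)

theory Defs
  imports Complex_Main "HOL-Library.Function_Algebras"
begin

section \<open>Vector spaces and tensor products\<close>

text \<open>A vector space over the field \<open>'k\<close> is a subspace of an ambient vector space given by
  a type and a scalar multiplication on it.  The subspaces of a family are not assumed to be
  independent or disjoint, so (embedding into the direct sum) an arbitrary family
  of vector spaces can be presented in this way.  Operations are constrained on the
  carriers only; their values elsewhere are irrelevant.\<close>

record ('k, 'v) vs =
  carrier :: "'v set"
  smult :: "'k \<Rightarrow> 'v \<Rightarrow> 'v"

definition vspace :: "('k::field, 'v::ab_group_add, 'm) vs_scheme \<Rightarrow> bool" where
  "vspace V \<longleftrightarrow> vector_space (smult V) \<and> module.subspace (smult V) (carrier V)"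

definition linmap ::
  "('k::field, 'u::ab_group_add, 'm) vs_scheme \<Rightarrow> ('k, 'v::ab_group_add, 'n) vs_scheme \<Rightarrow>
   ('u \<Rightarrow> 'v) \<Rightarrow> bool" where
  "linmap U V f \<longleftrightarrow>
     (\<forall>x\<in>carrier U. f x \<in> carrier V) \<and>
     (\<forall>x\<in>carrier U. \<forall>y\<in>carrier U. f (x + y) = f x + f y) \<and>
     (\<forall>c. \<forall>x\<in>carrier U. f (smult U c x) = smult V c (f x))"

definition bilin ::
  "('k::field, 'u::ab_group_add, 'm) vs_scheme \<Rightarrow> ('k, 'v::ab_group_add, 'n) vs_scheme \<Rightarrow>
   ('k, 'w::ab_group_add, 'o) vs_scheme \<Rightarrow> ('u \<Rightarrow> 'v \<Rightarrow> 'w) \<Rightarrow> bool" where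
  "bilin U V W b \<longleftrightarrow>
     (\<forall>u\<in>carrier U. linmap V W (b u)) \<and> (\<forall>v\<in>carrier V. linmap U W (\<lambda>u. b u v))"

definition base :: "('k::field, 'k) vs" where
  "base = \<lparr>carrier = UNIV, smult = (*)\<rparr>"

text \<open>The tensor product is realised inside the linear dual of the space of bilinear forms:
  the pure tensor of \<open>u\<close> and \<open>v\<close> is evaluation \<open>B \<mapsto> B u v\<close>, and \<open>U \<otimes> V\<close> consists of the
  finite sums of pure tensors.  The lemmas below show that this is the tensor
  product: it is a vector space, and every bilinear map on \<open>U \<times> V\<close> factors
  uniquely through it.  The lift of a bilinear map is computed from any representation
  as a finite sum of pure tensors.\<close>

type_synonym ('k, 'u, 'v) tens = "('u \<Rightarrow> 'v \<Rightarrow> 'k) \<Rightarrow> 'k"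

definition pure ::
  "('k::field, 'u::ab_group_add, 'm) vs_scheme \<Rightarrow> ('k, 'v::ab_group_add, 'n) vs_scheme \<Rightarrow>
   'u \<Rightarrow> 'v \<Rightarrow> ('k, 'u, 'v) tens" where
  "pure U V u v = (\<lambda>B. if bilin U V base B then B u v else 0)"

definition tensor ::
  "('k::field, 'u::ab_group_add, 'm) vs_scheme \<Rightarrow> ('k, 'v::ab_group_add, 'n) vs_scheme \<Rightarrow>
   ('k, ('k, 'u, 'v) tens) vs" where
  "tensor U V =
     \<lparr>carrier = {\<Sum>(u, v)\<leftarrow>xs. pure U V u v |xs. set xs \<subseteq> carrier U \<times> carrier V},
      smult = (\<lambda>c t B. c * t B)\<rparr>"

definition tensor_lift ::
  "('k::field, 'u::ab_group_add, 'm) vs_scheme \<Rightarrow> ('k, 'v::ab_group_add, 'n) vs_scheme \<Rightarrow>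
   ('u \<Rightarrow> 'v \<Rightarrow> 'w::ab_group_add) \<Rightarrow> ('k, 'u, 'v) tens \<Rightarrow> 'w" where
  "tensor_lift U V b t =
     (THE w. \<exists>xs. set xs \<subseteq> carrier U \<times> carrier V \<and>
        t = (\<Sum>(u, v)\<leftarrow>xs. pure U V u v) \<and> w = (\<Sum>(u, v)\<leftarrow>xs. b u v))"

lemma linmapD:
  assumes "linmap U V f"
  shows "x \<in> carrier U \<Longrightarrow> f x \<in> carrier V"
    and "x \<in> carrier U \<Longrightarrow> y \<in> carrier U \<Longrightarrow> f (x + y) = f x + f y"
    and "x \<in> carrier U \<Longrightarrow> f (smult U c x) = smult V c (f x)"
  using assms by (auto simp: linmap_def)

lemma bilinD:
  assumes "bilin U V W b" "u \<in> carrier U" "v \<in> carrier V"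
  shows "b u v \<in> carrier W"
    and "u' \<in> carrier U \<Longrightarrow> b (u + u') v = b u v + b u' v"
    and "v' \<in> carrier V \<Longrightarrow> b u (v + v') = b u v + b u v'"
    and "b (smult U c u) v = smult W c (b u v)"
    and "b u (smult V c v) = smult W c (b u v)"
  using assms unfolding bilin_def linmap_def by auto

lemma sum_list_in_vspace:
  assumes "vspace W" "bilin U V W b" "set xs \<subseteq> carrier U \<times> carrier V"
  shows "(\<Sum>(u, v)\<leftarrow>xs. b u v) \<in> carrier W"
proof -
  interpret vector_space "smult W" using assms(1) by (simp add: vspace_def)
  have W: "subspace (carrier W)" using assms(1) by (simp add: vspace_def)
  show ?thesis using assms(3)
    by (induction xs) (auto simp: subspace_0[OF W] intro!: subspace_add[OF W] bilinD(1)[OF assms(2)])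
qed

lemma sum_list_smult:
  assumes "vspace W" "bilin U V W b" "set xs \<subseteq> carrier U \<times> carrier V"
  shows "(\<Sum>(u, v)\<leftarrow>map (\<lambda>(u, v). (smult U c u, v)) xs. b u v) =
    smult W c (\<Sum>(u, v)\<leftarrow>xs. b u v)"
proof -
  interpret vector_space "smult W" using assms(1) by (simp add: vspace_def)
  show ?thesis using assms(3)
    by (induction xs) (auto simp: scale_right_distrib bilinD(4)[OF assms(2)])
qed

lemma sum_list_pure:
  "(\<Sum>(u, v)\<leftarrow>xs. pure U V u v) B =
     (if bilin U V base B then (\<Sum>(u, v)\<leftarrow>xs. B u v) else 0)"
  by (induction xs) (auto simp: pure_def)

lemma smult_closed: "vspace U \<Longrightarrow> u \<in> carrier U \<Longrightarrow> smult U c u \<in> carrier U"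
  unfolding vspace_def by (auto intro: module.subspace_scale simp: module_iff_vector_space)

lemma vspace_base: "vspace base"
proof -
  interpret vector_space "(*) :: 'a::field \<Rightarrow> 'a \<Rightarrow> 'a"
    by unfold_locales (auto simp: algebra_simps)
  show ?thesis unfolding vspace_def base_def
    by (simp add: vector_space_axioms)
qed

lemma bilin_pure: "bilin U V (tensor U V) (pure U V)"
  unfolding bilin_def linmap_def
proof (intro ballI conjI allI)
  fix u v assume uv: "u \<in> carrier U" "v \<in> carrier V"
  have "pure U V u v = (\<Sum>(u, v)\<leftarrow>[(u, v)]. pure U V u v)" by simp
  moreover have "set [(u, v)] \<subseteq> carrier U \<times> carrier V" using uv by simp
  ultimately show "pure U V u v \<in> carrier (tensor U V)"
    unfolding tensor_def vs.simps by blast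
  then show "pure U V u v \<in> carrier (tensor U V)" .
qed (auto simp: pure_def tensor_def fun_eq_iff bilinD base_def)

lemma vspace_tensor:
  assumes "vspace U"
  shows "vspace (tensor U V)"
proof -
  interpret vector_space "smult (tensor U V)"
    by unfold_locales (auto simp: tensor_def algebra_simps fun_eq_iff)
  have "subspace (carrier (tensor U V))"
    unfolding subspace_def
  proof (intro conjI ballI allI)
    have "(0 :: ('a, 'b, 'd) tens) = (\<Sum>(u, v)\<leftarrow>[]. pure U V u v)" by simp
    then show "0 \<in> carrier (tensor U V)" unfolding tensor_def vs.simps
      using empty_subsetI list.set(1) by (metis (mono_tags, lifting) mem_Collect_eq)
  next
    fix s t assume "s \<in> carrier (tensor U V)" "t \<in> carrier (tensor U V)"
    then obtain xs ys where "set xs \<subseteq> carrier U \<times> carrier V" "set ys \<subseteq> carrier U \<times> carrier V"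
      "s = (\<Sum>(u, v)\<leftarrow>xs. pure U V u v)" "t = (\<Sum>(u, v)\<leftarrow>ys. pure U V u v)"
      by (auto simp: tensor_def)
    then have "s + t = (\<Sum>(u, v)\<leftarrow>xs @ ys. pure U V u v)"
      "set (xs @ ys) \<subseteq> carrier U \<times> carrier V" by simp_all
    then show "s + t \<in> carrier (tensor U V)" unfolding tensor_def vs.simps by blast
  next
    fix c t assume "t \<in> carrier (tensor U V)"
    then obtain xs where xs: "set xs \<subseteq> carrier U \<times> carrier V"
      and t: "t = (\<Sum>(u, v)\<leftarrow>xs. pure U V u v)"
      by (auto simp: tensor_def)
    have "smult (tensor U V) c t =
        (\<Sum>(u, v)\<leftarrow>map (\<lambda>(u, v). (smult U c u, v)) xs. pure U V u v)"
    proof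
      fix B
      show "smult (tensor U V) c t B =
        (\<Sum>(u, v)\<leftarrow>map (\<lambda>(u, v). (smult U c u, v)) xs. pure U V u v) B"
      proof (cases "bilin U V base B")
        case True
        show ?thesis unfolding sum_list_pure sum_list_smult[OF vspace_base True xs]
          using True by (simp add: t tensor_def base_def sum_list_pure)
      next
        case False
        then show ?thesis unfolding sum_list_pure by (simp add: t tensor_def sum_list_pure)
      qed
    qed
    moreover have "set (map (\<lambda>(u, v). (smult U c u, v)) xs) \<subseteq> carrier U \<times> carrier V"
      using xs assms by (auto simp: smult_closed)
    ultimately show "smult (tensor U V) c t \<in> carrier (tensor U V)"
      unfolding tensor_def vs.simps by blast
  qed
  then show ?thesis by (simp add: vspace_def vector_space_axioms)
qed

lemma exists_functional:
  assumes "vspace W" "w \<noteq> 0"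
  shows "\<exists>\<phi>. linmap \<lparr>carrier = UNIV, smult = smult W\<rparr> base \<phi> \<and> \<phi> w \<noteq> 0"
proof -
  interpret W: vector_space "smult W" using assms(1) by (simp add: vspace_def)
  interpret K: vector_space "(*) :: 'a \<Rightarrow> 'a \<Rightarrow> 'a"
    by unfold_locales (auto simp: algebra_simps)
  interpret vector_space_pair "smult W" "(*) :: 'a \<Rightarrow> 'a \<Rightarrow> 'a" by unfold_locales
  have "W.independent {w}" using assms(2) by simp
  from linear_independent_extend[OF this, of "\<lambda>_. 1"]
  obtain \<phi> where "Vector_Spaces.linear (smult W) (*) \<phi>" "\<phi> w = 1" by auto
  then show ?thesis
    by (intro exI[of _ \<phi>]) (auto simp: linmap_def base_def Vector_Spaces.linear_iff)
qed

lemma sum_list_well_defined: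
  assumes W: "vspace W" and b: "bilin U V W b"
    and xs: "set xs \<subseteq> carrier U \<times> carrier V" and ys: "set ys \<subseteq> carrier U \<times> carrier V"
    and eq: "(\<Sum>(u, v)\<leftarrow>xs. pure U V u v) = (\<Sum>(u, v)\<leftarrow>ys. pure U V u v)"
  shows "(\<Sum>(u, v)\<leftarrow>xs. b u v) = (\<Sum>(u, v)\<leftarrow>ys. b u v)" (is "?X = ?Y")
proof (rule ccontr)
  assume "?X \<noteq> ?Y"
  then have "?X - ?Y \<noteq> 0" by simp
  from exists_functional[OF W this] obtain \<phi>
    where lin: "linmap \<lparr>carrier = UNIV, smult = smult W\<rparr> base \<phi>" and ne: "\<phi> (?X - ?Y) \<noteq> 0"
    by blast
  have add: "\<phi> (x + y) = \<phi> x + \<phi> y" for x y using lin by (simp add: linmap_def)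
  have "\<phi> 0 = \<phi> 0 + \<phi> 0" using add[of 0 0] by simp
  then have z: "\<phi> 0 = 0" by (metis add_cancel_right_right)
  have diff: "\<phi> (x - y) = \<phi> x - \<phi> y" for x y using add[of "x - y" y] by simp
  have "bilin U V base (\<lambda>u v. \<phi> (b u v))"
    using b lin by (auto simp: bilin_def linmap_def base_def)
  moreover have "\<phi> (\<Sum>(u, v)\<leftarrow>zs. b u v) = (\<Sum>(u, v)\<leftarrow>zs. \<phi> (b u v))" for zs
    by (induction zs) (auto simp: z add)
  ultimately have "\<phi> ?X = \<phi> ?Y"
    using fun_cong[OF eq, of "\<lambda>u v. \<phi> (b u v)"] by (simp add: sum_list_pure)
  then show False using ne diff by simp
qed

lemma tensor_lift_sum:
  assumes "vspace W" "bilin U V W b" "set xs \<subseteq> carrier U \<times> carrier V"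
  shows "tensor_lift U V b (\<Sum>(u, v)\<leftarrow>xs. pure U V u v) = (\<Sum>(u, v)\<leftarrow>xs. b u v)"
  unfolding tensor_lift_def
proof (rule the_equality)
  fix w assume "\<exists>ys. set ys \<subseteq> carrier U \<times> carrier V \<and>
    (\<Sum>(u, v)\<leftarrow>xs. pure U V u v) = (\<Sum>(u, v)\<leftarrow>ys. pure U V u v) \<and> w = (\<Sum>(u, v)\<leftarrow>ys. b u v)"
  then obtain ys where "set ys \<subseteq> carrier U \<times> carrier V"
    "(\<Sum>(u, v)\<leftarrow>xs. pure U V u v) = (\<Sum>(u, v)\<leftarrow>ys. pure U V u v)" "w = (\<Sum>(u, v)\<leftarrow>ys. b u v)"
    by (elim exE conjE)
  then show "w = (\<Sum>(u, v)\<leftarrow>xs. b u v)"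
    using sum_list_well_defined[OF assms(1,2,3)] by metis
qed (use assms(3) in blast)

lemma tensor_lift_pure:
  assumes "vspace W" "bilin U V W b" "u \<in> carrier U" "v \<in> carrier V"
  shows "tensor_lift U V b (pure U V u v) = b u v"
  using tensor_lift_sum[OF assms(1,2), of "[(u, v)]"] assms(3,4) by simp

lemma linmap_tensor_lift:
  assumes U: "vspace U" and W: "vspace W" and b: "bilin U V W b"
  shows "linmap (tensor U V) W (tensor_lift U V b)"
proof -
  have rep: "\<exists>xs. set xs \<subseteq> carrier U \<times> carrier V \<and> t = (\<Sum>(u, v)\<leftarrow>xs. pure U V u v)"
    if "t \<in> carrier (tensor U V)" for t using that by (auto simp: tensor_def)
  show ?thesis unfolding linmap_def
  proof (intro conjI ballI allI)
    fix t assume "t \<in> carrier (tensor U V)"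
    then show "tensor_lift U V b t \<in> carrier W"
      using rep tensor_lift_sum[OF W b] sum_list_in_vspace[OF W b] by metis
  next
    fix s t assume "s \<in> carrier (tensor U V)" "t \<in> carrier (tensor U V)"
    then obtain xs ys where xs: "set xs \<subseteq> carrier U \<times> carrier V" "s = (\<Sum>(u, v)\<leftarrow>xs. pure U V u v)"
      and ys: "set ys \<subseteq> carrier U \<times> carrier V" "t = (\<Sum>(u, v)\<leftarrow>ys. pure U V u v)"
      using rep by metis
    then show "tensor_lift U V b (s + t) = tensor_lift U V b s + tensor_lift U V b t"
      using tensor_lift_sum[OF W b, of "xs @ ys"] tensor_lift_sum[OF W b, of xs]
        tensor_lift_sum[OF W b, of ys] by simp
  next
    fix c t assume "t \<in> carrier (tensor U V)"
    then obtain xs where xs: "set xs \<subseteq> carrier U \<times> carrier V" "t = (\<Sum>(u, v)\<leftarrow>xs. pure U V u v)"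
      using rep by metis
    let ?ys = "map (\<lambda>(u, v). (smult U c u, v)) xs"
    have ys: "set ?ys \<subseteq> carrier U \<times> carrier V" using xs(1) U by (auto simp: smult_closed)
    have "smult (tensor U V) c t = (\<Sum>(u, v)\<leftarrow>?ys. pure U V u v)"
      unfolding xs(2) by (rule sum_list_smult[OF vspace_tensor[OF U] bilin_pure xs(1), symmetric])
    then show "tensor_lift U V b (smult (tensor U V) c t) = smult W c (tensor_lift U V b t)"
      using tensor_lift_sum[OF W b ys] tensor_lift_sum[OF W b xs(1)] sum_list_smult[OF W b xs(1)]
        xs(2) by metis
  qed
qed

lemma tensor_lift_unique:
  assumes U: "vspace U" and W: "vspace W" and b: "bilin U V W b"
    and f: "linmap (tensor U V) W f"
      "\<And>u v. u \<in> carrier U \<Longrightarrow> v \<in> carrier V \<Longrightarrow> f (pure U V u v) = b u v"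
    and t: "t \<in> carrier (tensor U V)"
  shows "f t = tensor_lift U V b t"
proof -
  obtain xs where xs: "set xs \<subseteq> carrier U \<times> carrier V" "t = (\<Sum>(u, v)\<leftarrow>xs. pure U V u v)"
    using t by (auto simp: tensor_def)
  have mem: "(\<Sum>(u, v)\<leftarrow>ys. pure U V u v) \<in> carrier (tensor U V)"
    if "set ys \<subseteq> carrier U \<times> carrier V" for ys using that by (auto simp: tensor_def)
  have "f 0 = 0" using linmapD(2)[OF f(1), of 0 0] mem[of "[]"] by simp
  then have "f (\<Sum>(u, v)\<leftarrow>xs. pure U V u v) = (\<Sum>(u, v)\<leftarrow>xs. b u v)"
    using xs(1)
  proof (induction xs)
    case (Cons p xs)
    obtain u v where p: "p = (u, v)" by (cases p)
    have uv: "u \<in> carrier U" "v \<in> carrier V" using Cons.prems p by auto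
    have "pure U V u v \<in> carrier (tensor U V)" using bilinD(1)[OF bilin_pure uv] .
    then have "f (pure U V u v + (\<Sum>(u, v)\<leftarrow>xs. pure U V u v)) =
        b u v + (\<Sum>(u, v)\<leftarrow>xs. b u v)"
      using Cons linmapD(2)[OF f(1) _ mem[of xs]] f(2)[OF uv] by simp
    then show ?case unfolding p list.map sum_list.Cons prod.case .
  qed (simp add: zero_fun_def)
  then show ?thesis using tensor_lift_sum[OF W b xs(1)] xs(2) by simp
qed

definition tensor_map ::
  "('k::field, 'u::ab_group_add, 'm) vs_scheme \<Rightarrow> ('k, 'v::ab_group_add, 'n) vs_scheme \<Rightarrow>
   ('k, 'u'::ab_group_add, 'm') vs_scheme \<Rightarrow> ('k, 'v'::ab_group_add, 'n') vs_scheme \<Rightarrow>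
   ('u \<Rightarrow> 'u') \<Rightarrow> ('v \<Rightarrow> 'v') \<Rightarrow> ('k, 'u, 'v) tens \<Rightarrow> ('k, 'u', 'v') tens" where
  "tensor_map U V U' V' f g = tensor_lift U V (\<lambda>u v. pure U' V' (f u) (g v))"

definition tensor_assoc ::
  "('k::field, 'u::ab_group_add, 'm) vs_scheme \<Rightarrow> ('k, 'v::ab_group_add, 'n) vs_scheme \<Rightarrow>
   ('k, 'w::ab_group_add, 'o) vs_scheme \<Rightarrow>
   ('k, ('k, 'u, 'v) tens, 'w) tens \<Rightarrow> ('k, 'u, ('k, 'v, 'w) tens) tens" where
  "tensor_assoc U V W =
     tensor_lift (tensor U V) W
       (\<lambda>t w. tensor_lift U V (\<lambda>u v. pure U (tensor V W) u (pure V W v w)) t)"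

definition tensor_flip ::
  "('k::field, 'u::ab_group_add, 'm) vs_scheme \<Rightarrow> ('k, 'v::ab_group_add, 'n) vs_scheme \<Rightarrow>
   ('k, 'u, 'v) tens \<Rightarrow> ('k, 'v, 'u) tens" where
  "tensor_flip U V = tensor_lift U V (\<lambda>u v. pure V U v u)"


section \<open>Coalgebras\<close>

record ('k, 'v) coalg = "('k, 'v) vs" +
  comult :: "'v \<Rightarrow> ('k, 'v, 'v) tens"
  counit :: "'v \<Rightarrow> 'k"

text \<open>Sweedler notation: \<open>sweedler C x (\<lambda>x\<^sub>1 x\<^sub>2. b x\<^sub>1 x\<^sub>2)\<close>
  stands for \<open>b x\<^sub>(\<^sub>1\<^sub>) x\<^sub>(\<^sub>2\<^sub>)\<close>, where \<open>b\<close> is bilinear.\<close>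

definition sweedler ::
  "('k::field, 'v::ab_group_add, 'm) coalg_scheme \<Rightarrow> 'v \<Rightarrow> ('v \<Rightarrow> 'v \<Rightarrow> 'w::ab_group_add) \<Rightarrow> 'w"
  where "sweedler C x b = tensor_lift C C b (comult C x)"

definition coalgebra :: "('k::field, 'v::ab_group_add, 'm) coalg_scheme \<Rightarrow> bool" where
  "coalgebra C \<longleftrightarrow>
     vspace C \<and> linmap C (tensor C C) (comult C) \<and> linmap C base (counit C) \<and>
     (\<forall>x\<in>carrier C.
        tensor_assoc C C C (tensor_map C C (tensor C C) C (comult C) id (comult C x)) =
        tensor_map C C C (tensor C C) id (comult C) (comult C x)) \<and>
     (\<forall>x\<in>carrier C. sweedler C x (\<lambda>x1 x2. smult C (counit C x1) x2) = x) \<and>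
     (\<forall>x\<in>carrier C. sweedler C x (\<lambda>x1 x2. smult C (counit C x2) x1) = x)"

definition cocommutative :: "('k::field, 'v::ab_group_add, 'm) coalg_scheme \<Rightarrow> bool" where
  "cocommutative C \<longleftrightarrow> (\<forall>x\<in>carrier C. tensor_flip C C (comult C x) = comult C x)"

definition coalg_hom ::
  "('k::field, 'v::ab_group_add, 'm) coalg_scheme \<Rightarrow> ('k, 'w::ab_group_add, 'n) coalg_scheme \<Rightarrow>
   ('v \<Rightarrow> 'w) \<Rightarrow> bool" where
  "coalg_hom C D f \<longleftrightarrow>
     linmap C D f \<and>
     (\<forall>x\<in>carrier C. comult D (f x) = tensor_map C C D D f f (comult C x)) \<and>
     (\<forall>x\<in>carrier C. counit D (f x) = counit C x)"

definition base_coalg :: "('k::field, 'k) coalg" where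
  "base_coalg = \<lparr>carrier = UNIV, smult = (*), comult = (\<lambda>c. pure base base c 1), counit = id\<rparr>"

text \<open>The tensor product of two coalgebras, with comultiplication
  \<open>c \<otimes> d \<mapsto> (c\<^sub>(\<^sub>1\<^sub>) \<otimes> d\<^sub>(\<^sub>1\<^sub>)) \<otimes> (c\<^sub>(\<^sub>2\<^sub>) \<otimes> d\<^sub>(\<^sub>2\<^sub>))\<close>.\<close>

definition tensor_coalg ::
  "('k::field, 'u::ab_group_add, 'm) coalg_scheme \<Rightarrow> ('k, 'v::ab_group_add, 'n) coalg_scheme \<Rightarrow>
   ('k, ('k, 'u, 'v) tens) coalg" where
  "tensor_coalg C D =
     \<lparr>carrier = carrier (tensor C D), smult = smult (tensor C D),
      comult = tensor_lift C D (\<lambda>c d.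
        sweedler C c (\<lambda>c1 c2. sweedler D d (\<lambda>d1 d2.
          pure (tensor C D) (tensor C D) (pure C D c1 d1) (pure C D c2 d2)))),
      counit = tensor_lift C D (\<lambda>c d. counit C c * counit D d)\<rparr>"

text \<open>Linear maps \<open>C \<otimes> D \<rightarrow> E\<close> are given by the corresponding bilinear maps.\<close>

definition bilin_coalg_hom ::
  "('k::field, 'u::ab_group_add, 'm) coalg_scheme \<Rightarrow> ('k, 'v::ab_group_add, 'n) coalg_scheme \<Rightarrow>
   ('k, 'w::ab_group_add, 'o) coalg_scheme \<Rightarrow> ('u \<Rightarrow> 'v \<Rightarrow> 'w) \<Rightarrow> bool" where
  "bilin_coalg_hom C D E b \<longleftrightarrow>
     bilin C D E b \<and> coalg_hom (tensor_coalg C D) E (tensor_lift C D b)"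


section \<open>Hopf algebras and Hopf group-algebras\<close>

locale hopf_algebra =
  fixes A :: "('k::field, 'a::ab_group_add) coalg"
    and mul :: "'a \<Rightarrow> 'a \<Rightarrow> 'a"
    and one :: 'a
    and S :: "'a \<Rightarrow> 'a"
  assumes coalg: "coalgebra A"
    and mul_hom: "bilin_coalg_hom A A A mul"
    and one_closed: "one \<in> carrier A"
    and unit_hom: "coalg_hom base_coalg A (\<lambda>c. smult A c one)"
    and assoc: "\<lbrakk>x \<in> carrier A; y \<in> carrier A; z \<in> carrier A\<rbrakk> \<Longrightarrow>
      mul (mul x y) z = mul x (mul y z)"
    and unit_left: "x \<in> carrier A \<Longrightarrow> mul one x = x"
    and unit_right: "x \<in> carrier A \<Longrightarrow> mul x one = x"
    and antipode_linear: "linmap A A S"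
    and antipode_left: "x \<in> carrier A \<Longrightarrow>
      sweedler A x (\<lambda>x1 x2. mul (S x1) x2) = smult A (counit A x) one"
    and antipode_right: "x \<in> carrier A \<Longrightarrow>
      sweedler A x (\<lambda>x1 x2. mul x1 (S x2)) = smult A (counit A x) one"

text \<open>The abelian group \<open>\<pi>\<close> is the type \<open>'p\<close>, written additively: \<open>\<alpha>\<beta>\<close> becomes \<open>\<alpha> + \<beta>\<close>,
  the inverse of \<open>\<alpha>\<close> is \<open>- \<alpha>\<close>, and \<open>e\<close> is \<open>0\<close>.\<close>

locale hopf_pi_algebra =
  fixes H :: "'p::ab_group_add \<Rightarrow> ('k::field, 'v::ab_group_add) coalg"
    and mul :: "'p \<Rightarrow> 'p \<Rightarrow> 'v \<Rightarrow> 'v \<Rightarrow> 'v"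
    and one :: 'v
    and S :: "'p \<Rightarrow> 'v \<Rightarrow> 'v"
  assumes coalg: "coalgebra (H \<alpha>)"
    and mul_hom: "bilin_coalg_hom (H \<alpha>) (H \<beta>) (H (\<alpha> + \<beta>)) (mul \<alpha> \<beta>)"
    and one_closed: "one \<in> carrier (H 0)"
    and unit_hom: "coalg_hom base_coalg (H 0) (\<lambda>c. smult (H 0) c one)"
    and assoc: "\<lbrakk>x \<in> carrier (H \<alpha>); y \<in> carrier (H \<beta>); z \<in> carrier (H \<gamma>)\<rbrakk> \<Longrightarrow>
      mul (\<alpha> + \<beta>) \<gamma> (mul \<alpha> \<beta> x y) z = mul \<alpha> (\<beta> + \<gamma>) x (mul \<beta> \<gamma> y z)"
    and unit_left: "x \<in> carrier (H \<alpha>) \<Longrightarrow> mul 0 \<alpha> one x = x"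
    and unit_right: "x \<in> carrier (H \<alpha>) \<Longrightarrow> mul \<alpha> 0 x one = x"
    and antipode_linear: "linmap (H \<alpha>) (H (- \<alpha>)) (S \<alpha>)"
    and antipode_left: "x \<in> carrier (H \<alpha>) \<Longrightarrow>
      sweedler (H \<alpha>) x (\<lambda>x1 x2. mul (- \<alpha>) \<alpha> (S \<alpha> x1) x2) =
      smult (H 0) (counit (H \<alpha>) x) one"
    and antipode_right: "x \<in> carrier (H \<alpha>) \<Longrightarrow>
      sweedler (H \<alpha>) x (\<lambda>x1 x2. mul \<alpha> (- \<alpha>) x1 (S \<alpha> x2)) =
      smult (H 0) (counit (H \<alpha>) x) one"


section \<open>Post-Hopf group-algebras\<close>

text \<open>\<open>conv_inverse_of C D \<theta> \<psi>\<close>: in the convolution algebra \<open>Hom(C, End(D))\<close>, \<open>\<psi>\<close> is inverse to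
  \<open>\<theta>\<close>.  Maps \<open>C \<rightarrow> End(D)\<close> are curried; the last conjunct fixes
  the irrelevant values outside the carriers, so that the inverse is unique as a function.\<close>

definition conv_inverse_of ::
  "('k::field, 'u::ab_group_add) coalg \<Rightarrow> ('k, 'v::ab_group_add) coalg \<Rightarrow>
   ('u \<Rightarrow> 'v \<Rightarrow> 'v) \<Rightarrow> ('u \<Rightarrow> 'v \<Rightarrow> 'v) \<Rightarrow> bool" where
  "conv_inverse_of C D \<theta> \<psi> \<longleftrightarrow>
     bilin C D D \<psi> \<and>
     (\<forall>x\<in>carrier C. \<forall>y\<in>carrier D.
        sweedler C x (\<lambda>x1 x2. \<psi> x1 (\<theta> x2 y)) = smult D (counit C x) y \<and>
        sweedler C x (\<lambda>x1 x2. \<theta> x1 (\<psi> x2 y)) = smult D (counit C x) y) \<and>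
     (\<forall>x y. x \<notin> carrier C \<or> y \<notin> carrier D \<longrightarrow> \<psi> x y = 0)"

definition conv_inverse ::
  "('k::field, 'u::ab_group_add) coalg \<Rightarrow> ('k, 'v::ab_group_add) coalg \<Rightarrow>
   ('u \<Rightarrow> 'v \<Rightarrow> 'v) \<Rightarrow> 'u \<Rightarrow> 'v \<Rightarrow> 'v" where
  "conv_inverse C D \<theta> = (THE \<psi>. conv_inverse_of C D \<theta> \<psi>)"

locale post_hopf_pi_algebra = hopf_pi_algebra H mul one S
  for H :: "'p::ab_group_add \<Rightarrow> ('k::field, 'v::ab_group_add) coalg"
    and mul :: "'p \<Rightarrow> 'p \<Rightarrow> 'v \<Rightarrow> 'v \<Rightarrow> 'v"
    and one :: 'v
    and S :: "'p \<Rightarrow> 'v \<Rightarrow> 'v" +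
  fixes act :: "'p \<Rightarrow> 'p \<Rightarrow> 'v \<Rightarrow> 'v \<Rightarrow> 'v"
  assumes act_hom: "bilin_coalg_hom (H \<alpha>) (H \<beta>) (H \<beta>) (act \<alpha> \<beta>)"
    and act_mul: "\<lbrakk>x \<in> carrier (H \<alpha>); y \<in> carrier (H \<beta>); z \<in> carrier (H \<gamma>)\<rbrakk> \<Longrightarrow>
      act \<alpha> (\<beta> + \<gamma>) x (mul \<beta> \<gamma> y z) =
      sweedler (H \<alpha>) x (\<lambda>x1 x2. mul \<beta> \<gamma> (act \<alpha> \<beta> x1 y) (act \<alpha> \<gamma> x2 z))"
    and act_act: "\<lbrakk>x \<in> carrier (H \<alpha>); y \<in> carrier (H \<beta>); z \<in> carrier (H \<gamma>)\<rbrakk> \<Longrightarrow>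
      act \<alpha> \<gamma> x (act \<beta> \<gamma> y z) =
      act (\<alpha> + \<beta>) \<gamma> (sweedler (H \<alpha>) x (\<lambda>x1 x2. mul \<alpha> \<beta> x1 (act \<alpha> \<beta> x2 y))) z"
    and act_conv_invertible: "\<exists>!\<psi>. conv_inverse_of (H \<alpha>) (H \<beta>) (act \<alpha> \<beta>) \<psi>"

definition star_mul ::
  "('p::ab_group_add \<Rightarrow> ('k::field, 'v::ab_group_add) coalg) \<Rightarrow>
   ('p \<Rightarrow> 'p \<Rightarrow> 'v \<Rightarrow> 'v \<Rightarrow> 'v) \<Rightarrow> ('p \<Rightarrow> 'p \<Rightarrow> 'v \<Rightarrow> 'v \<Rightarrow> 'v) \<Rightarrow> 'p \<Rightarrow> 'p \<Rightarrow> 'v \<Rightarrow> 'v \<Rightarrow> 'v" where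
  "star_mul H mul act \<alpha> \<beta> x y =
     sweedler (H \<alpha>) x (\<lambda>x1 x2. mul \<alpha> \<beta> x1 (act \<alpha> \<beta> x2 y))"

definition star_antipode ::
  "('p::ab_group_add \<Rightarrow> ('k::field, 'v::ab_group_add) coalg) \<Rightarrow>
   ('p \<Rightarrow> 'v \<Rightarrow> 'v) \<Rightarrow> ('p \<Rightarrow> 'p \<Rightarrow> 'v \<Rightarrow> 'v \<Rightarrow> 'v) \<Rightarrow> 'p \<Rightarrow> 'v \<Rightarrow> 'v" where
  "star_antipode H S act \<alpha> x =
     sweedler (H \<alpha>) x (\<lambda>x1 x2. conv_inverse (H \<alpha>) (H (- \<alpha>)) (act \<alpha> (- \<alpha>)) x1 (S \<alpha> x2))"


section \<open>Modulelike bialgebras\<close>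

locale modulelike_bialgebra =
  K: hopf_pi_algebra K mulK oneK SK + A: hopf_algebra A mulA oneA SA
  for K :: "'p::ab_group_add \<Rightarrow> ('k::field, 'v::ab_group_add) coalg"
    and mulK :: "'p \<Rightarrow> 'p \<Rightarrow> 'v \<Rightarrow> 'v \<Rightarrow> 'v"
    and oneK :: 'v
    and SK :: "'p \<Rightarrow> 'v \<Rightarrow> 'v"
    and A :: "('k, 'a::ab_group_add) coalg"
    and mulA :: "'a \<Rightarrow> 'a \<Rightarrow> 'a"
    and oneA :: 'a
    and SA :: "'a \<Rightarrow> 'a" +
  fixes act :: "'p \<Rightarrow> 'v \<Rightarrow> 'a \<Rightarrow> 'a"
  assumes act_bilin: "bilin (K \<alpha>) A A (act \<alpha>)"
    and act_mult: "\<lbrakk>k \<in> carrier (K \<alpha>); l \<in> carrier (K \<beta>); a \<in> carrier A\<rbrakk> \<Longrightarrow>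
      act (\<alpha> + \<beta>) (mulK \<alpha> \<beta> k l) a = act \<alpha> k (act \<beta> l a)"
    and act_one: "a \<in> carrier A \<Longrightarrow> act 0 oneK a = a"
    and act_prod: "\<lbrakk>k \<in> carrier (K \<alpha>); a \<in> carrier A; b \<in> carrier A\<rbrakk> \<Longrightarrow>
      act \<alpha> k (mulA a b) = sweedler (K \<alpha>) k (\<lambda>k1 k2. mulA (act \<alpha> k1 a) (act \<alpha> k2 b))"
    and act_unit: "k \<in> carrier (K \<alpha>) \<Longrightarrow> act \<alpha> k oneA = smult A (counit (K \<alpha>) k) oneA"
    and act_comult: "\<lbrakk>k \<in> carrier (K \<alpha>); a \<in> carrier A\<rbrakk> \<Longrightarrow>
      comult A (act \<alpha> k a) =
      sweedler (K \<alpha>) k (\<lambda>k1 k2. sweedler A a (\<lambda>a1 a2. pure A A (act \<alpha> k1 a1) (act \<alpha> k2 a2)))"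
    and act_counit: "\<lbrakk>k \<in> carrier (K \<alpha>); a \<in> carrier A\<rbrakk> \<Longrightarrow>
      counit A (act \<alpha> k a) = counit (K \<alpha>) k * counit A a"

end

(* For c in H_alpha, left star-multiplication z |-> c * z = c1 (c2 |> z) is a composite of two
   convolution-invertible maps, with convolution inverse c |-> (v |-> psi_{c1} (S c2 v)).  Its value
   at v = 1 is T c, which gives the right antipode law.  Associativity of * and the two inverse laws
   show that the inverse is v |-> T c * v; evaluating at c2 * 1 gives the left antipode law, without
   any need to know that T, psi or S are coalgebra maps.  Cocommutativity is used only to see that
   * is a coalgebra map. *)

theory Submission
  imports Defs
begin

section \<open>Sweedler sums\<close>

text \<open>The convolution inverse is found by reading c1 (c2 \<triangleright> z) as a convolution
  product of left multiplication L and the action \<theta>. The antipode axioms make L \<circ> S the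
  inverse of L, and \<psi> is the inverse of \<theta>; inverting a product reverses its factors,
  which gives \<psi> at c1 followed by S c2. In the graded setting left star multiplication by an
  element of degree \<alpha> shifts degrees by \<alpha>, so it does not take values in one
  endomorphism algebra, and the two inverse laws are separate identities with their own degrees.

  Neither x \<triangleright> 1 = \<epsilon>(x) 1 nor 1 \<triangleright> y = y is an axiom, yet 1
  must be a unit for the new product. Both come from an idempotent that is cancelled: the first by
  the antipode of H_e, the second by \<psi>.

  The formal obstacle is that \<open>sweedler\<close> has its meaning only on bilinear summands,
  while the coalgebra axioms are equations between tensors. Calculations with up to four components
  therefore run on finite sums, and multilinearity is checked only where a coalgebra axiom is
  invoked.\<close>

lemma vspaceD:
  assumes "vspace W"
  shows "0 \<in> carrier W"
    and "x \<in> carrier W \<Longrightarrow> y \<in> carrier W \<Longrightarrow> x + y \<in> carrier W"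
    and "smult W c 0 = 0"
    and "smult W c (x + y) = smult W c x + smult W c y"
    and "smult W (c + d) x = smult W c x + smult W d x"
    and "smult W c (smult W d x) = smult W (c * d) x"
    and "smult W 1 x = x"
    and "smult W 0 x = 0"
proof -
  interpret vector_space "smult W" using assms by (simp add: vspace_def)
  have W: "subspace (carrier W)" using assms by (simp add: vspace_def)
  show "0 \<in> carrier W" using subspace_0[OF W] .
  show "x \<in> carrier W \<Longrightarrow> y \<in> carrier W \<Longrightarrow> x + y \<in> carrier W" using subspace_add[OF W] .
  show "smult W c 0 = 0" "smult W c (x + y) = smult W c x + smult W c y"
    "smult W (c + d) x = smult W c x + smult W d x" "smult W c (smult W d x) = smult W (c * d) x"
    "smult W 1 x = x" "smult W 0 x = 0"
    by (simp_all add: scale_right_distrib scale_left_distrib)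
qed

section \<open>Linear and bilinear maps on carriers, and linearity in a parameter\<close>

lemma linmap_zero: "vspace U \<Longrightarrow> linmap U V f \<Longrightarrow> f 0 = 0"
  using linmapD(2)[of U V f 0 0] vspaceD(1)[of U] by simp

lemma linmap_sum_list:
  assumes "vspace U" "linmap U V f" "\<And>p. p \<in> set xs \<Longrightarrow> g p \<in> carrier U"
  shows "f (sum_list (map g xs)) = sum_list (map (\<lambda>p. f (g p)) xs)"
proof -
  have "sum_list (map g xs) \<in> carrier U \<and>
    f (sum_list (map g xs)) = sum_list (map (\<lambda>p. f (g p)) xs)"
    using assms(3)
    by (induction xs)
      (auto simp: vspaceD[OF assms(1)] linmap_zero[OF assms(1,2)] linmapD[OF assms(2)])
  then show ?thesis ..
qed

lemma bilinI:
  assumes "\<And>u. u \<in> carrier U \<Longrightarrow> linmap V W (b u)"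
    and "\<And>v. v \<in> carrier V \<Longrightarrow> linmap U W (\<lambda>u. b u v)"
  shows "bilin U V W b"
  using assms by (simp add: bilin_def)

lemma linmap_bilin_left:
  "bilin U V W b \<Longrightarrow> linmap X U f \<Longrightarrow> v \<in> carrier V \<Longrightarrow> linmap X W (\<lambda>x. b (f x) v)"
  by (auto simp: linmap_def bilin_def)

lemma linmap_bilin_right:
  "bilin U V W b \<Longrightarrow> u \<in> carrier U \<Longrightarrow> linmap X V f \<Longrightarrow> linmap X W (\<lambda>x. b u (f x))"
  by (auto simp: linmap_def bilin_def)

lemma linmap_compose: "linmap V W g \<Longrightarrow> linmap U V f \<Longrightarrow> linmap U W (\<lambda>x. g (f x))"
  by (auto simp: linmap_def)

lemma linmap_id: "linmap U U (\<lambda>x. x)"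
  by (auto simp: linmap_def)

lemma linmap_smult:
  assumes "vspace W" "linmap U W f"
  shows "linmap U W (\<lambda>x. smult W c (f x))"
  using assms smult_closed[OF assms(1)] vspaceD[OF assms(1)]
  by (auto simp: linmap_def mult.commute)

lemma linmap_smult_left:
  assumes "vspace W" "linmap U base f" "w \<in> carrier W"
  shows "linmap U W (\<lambda>x. smult W (f x) w)"
  using assms smult_closed[OF assms(1)] vspaceD[OF assms(1)]
  by (auto simp: linmap_def base_def)

lemma linmap_pair_sum:
  assumes W: "vspace W" and xs: "set xs \<subseteq> A \<times> B"
    and t: "\<And>a b. a \<in> A \<Longrightarrow> b \<in> B \<Longrightarrow> linmap U W (\<lambda>x. t x a b)"
  shows "linmap U W (\<lambda>x. \<Sum>(u, v)\<leftarrow>xs. t x u v)"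
  using xs
proof (induction xs)
  case Nil
  interpret vector_space "smult W" using W by (simp add: vspace_def)
  show ?case by (simp add: linmap_def vspaceD(1)[OF W])
next
  case (Cons p xs)
  obtain u v where p: "p = (u, v)" by (cases p)
  have "linmap U W (\<lambda>x. t x u v)" using t Cons.prems p by simp
  then show ?case using Cons p by (auto simp: linmap_def vspaceD[OF W] algebra_simps)
qed

text \<open>One representation of \<open>s\<close> by pure tensors serves all \<open>x\<close> at
  once, so the lift becomes the same finite sum for every \<open>x\<close>, and linearity can be
  checked summand by summand.\<close>

lemma linmap_tensor_lift_inside:
  assumes U: "vspace U" and W: "vspace W" and b: "\<And>x. x \<in> carrier U \<Longrightarrow> bilin C D W (t x)"
    and t: "\<And>c d. c \<in> carrier C \<Longrightarrow> d \<in> carrier D \<Longrightarrow> linmap U W (\<lambda>x. t x c d)"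
    and s: "s \<in> carrier (tensor C D)"
  shows "linmap U W (\<lambda>x. tensor_lift C D (t x) s)"
proof -
  obtain xs where xs: "set xs \<subseteq> carrier C \<times> carrier D" "s = (\<Sum>(u, v)\<leftarrow>xs. pure C D u v)"
    using s by (auto simp: tensor_def)
  show ?thesis
    using linmap_pair_sum[OF W xs(1) t] tensor_lift_sum[OF W b xs(1)] U
    unfolding xs(2) by (auto simp: linmap_def vspaceD smult_closed)
qed

section \<open>Sums over a chosen representation of the coproduct\<close>

definition sweedler_rep ::
  "('k::field, 'v::ab_group_add, 'm) coalg_scheme \<Rightarrow> 'v \<Rightarrow> ('v \<times> 'v) list" where
  "sweedler_rep C x =
     (if comult C x \<in> carrier (tensor C C)
      then SOME xs. set xs \<subseteq> carrier C \<times> carrier C \<and> comult C x = (\<Sum>(u, v)\<leftarrow>xs. pure C C u v)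
      else [])"

text \<open>Unlike \<^const>\<open>sweedler\<close>, a sum over a fixed representation of the coproduct commutes
  with linear maps and with other such sums without any bilinearity assumption.\<close>

definition sw ::
  "('k::field, 'v::ab_group_add, 'm) coalg_scheme \<Rightarrow> 'v \<Rightarrow> ('v \<Rightarrow> 'v \<Rightarrow> 'w::ab_group_add) \<Rightarrow> 'w"
  where "sw C x b = (\<Sum>(u, v)\<leftarrow>sweedler_rep C x. b u v)"

text \<open>The empty list as default makes the first claim hold for every \<open>x\<close>, so
  congruence and closure of \<open>sw\<close> carry no side condition on the element that is
  split.\<close>

lemma sweedler_rep:
  shows "set (sweedler_rep C x) \<subseteq> carrier C \<times> carrier C"
    and "comult C x \<in> carrier (tensor C C) \<Longrightarrow>
      comult C x = (\<Sum>(u, v)\<leftarrow>sweedler_rep C x. pure C C u v)"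
proof -
  have "set (sweedler_rep C x) \<subseteq> carrier C \<times> carrier C \<and>
      comult C x = (\<Sum>(u, v)\<leftarrow>sweedler_rep C x. pure C C u v)"
    if "comult C x \<in> carrier (tensor C C)"
  proof -
    have "\<exists>xs. set xs \<subseteq> carrier C \<times> carrier C \<and> comult C x = (\<Sum>(u, v)\<leftarrow>xs. pure C C u v)"
      using that unfolding tensor_def by auto
    from someI_ex[OF this] show ?thesis using that by (simp add: sweedler_rep_def)
  qed
  moreover have "sweedler_rep C x = []" if "comult C x \<notin> carrier (tensor C C)"
    using that by (simp add: sweedler_rep_def)
  ultimately show "set (sweedler_rep C x) \<subseteq> carrier C \<times> carrier C"
    and "comult C x \<in> carrier (tensor C C) \<Longrightarrow>
      comult C x = (\<Sum>(u, v)\<leftarrow>sweedler_rep C x. pure C C u v)"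
    by (cases "comult C x \<in> carrier (tensor C C)"; auto)+
qed

text \<open>As a congruence rule this hands the simplifier the membership of both components in the
  carrier, which is the premise of nearly every rewrite applied under a sum.\<close>

lemma sw_cong [cong]:
  assumes "x = y" "\<And>u v. u \<in> carrier C \<Longrightarrow> v \<in> carrier C \<Longrightarrow> b u v = b' u v"
  shows "sw C x b = sw C y b'"
  unfolding sw_def assms(1)
  using sweedler_rep(1)[of C y] assms(2)
  by (intro arg_cong[of _ _ sum_list] map_cong) auto

lemma sw_closed:
  assumes "vspace W" "\<And>u v. u \<in> carrier C \<Longrightarrow> v \<in> carrier C \<Longrightarrow> b u v \<in> carrier W"
  shows "sw C x b \<in> carrier W"
proof -
  have "set xs \<subseteq> carrier C \<times> carrier C \<Longrightarrow> (\<Sum>(u, v)\<leftarrow>xs. b u v) \<in> carrier W" for xs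
    using assms(2) by (induction xs) (auto simp: vspaceD[OF assms(1)])
  then show ?thesis unfolding sw_def using sweedler_rep(1)[of C x] .
qed

lemma linmap_sw_outside:
  assumes "vspace U" "linmap U V f" "\<And>u v. u \<in> carrier C \<Longrightarrow> v \<in> carrier C \<Longrightarrow> b u v \<in> carrier U"
  shows "f (sw C x b) = sw C x (\<lambda>u v. f (b u v))"
proof -
  have "f (\<Sum>(u, v)\<leftarrow>sweedler_rep C x. b u v) =
      (\<Sum>p\<leftarrow>sweedler_rep C x. f (case p of (u, v) \<Rightarrow> b u v))"
    using sweedler_rep(1)[of C x] assms(3) by (intro linmap_sum_list[OF assms(1,2)]) auto
  then show ?thesis unfolding sw_def by (simp add: case_prod_unfold)
qed

lemma sw_swap:
  fixes f :: "'a::ab_group_add \<Rightarrow> 'a \<Rightarrow> 'b::ab_group_add \<Rightarrow> 'b \<Rightarrow> 'w::ab_group_add"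
  shows "sw C x (\<lambda>a b. sw D y (\<lambda>c d. f a b c d)) = sw D y (\<lambda>c d. sw C x (\<lambda>a b. f a b c d))"
proof -
  have "(\<Sum>p\<leftarrow>xs. \<Sum>q\<leftarrow>ys. g p q) = (\<Sum>q\<leftarrow>ys. \<Sum>p\<leftarrow>xs. g p q)"
    for xs ys and g :: "'a \<times> 'a \<Rightarrow> 'b \<times> 'b \<Rightarrow> 'w"
    by (induction xs) (simp_all add: sum_list_addf)
  then show ?thesis unfolding sw_def case_prod_unfold .
qed

lemma linmap_sw_inside:
  assumes W: "vspace W" and t: "\<And>a b. a \<in> carrier C \<Longrightarrow> b \<in> carrier C \<Longrightarrow> linmap U W (\<lambda>x. t x a b)"
  shows "linmap U W (\<lambda>x. sw C y (t x))"
proof -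
  show ?thesis unfolding sw_def by (rule linmap_pair_sum[OF W sweedler_rep(1) t])
qed

section \<open>Counit, cocommutativity and coassociativity for these sums\<close>

lemma coalgebraD:
  assumes "coalgebra C"
  shows "vspace C" "linmap C (tensor C C) (comult C)" "linmap C base (counit C)"
    "x \<in> carrier C \<Longrightarrow> comult C x \<in> carrier (tensor C C)"
  using assms linmapD(1)[of C "tensor C C" "comult C" x] by (auto simp: coalgebra_def)

lemma tensor_lift_comult:
  assumes "coalgebra C" "vspace W" "bilin C C W b" "x \<in> carrier C"
  shows "tensor_lift C C b (comult C x) = sw C x b"
  using sweedler_rep(2)[OF coalgebraD(4)[OF assms(1,4)]]
    tensor_lift_sum[OF assms(2,3) sweedler_rep(1)[of C x]] by (simp add: sw_def)

lemma sweedler_eq_sw: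
  assumes "coalgebra C" "vspace W" "bilin C C W b" "x \<in> carrier C"
  shows "sweedler C x b = sw C x b"
  unfolding sweedler_def using tensor_lift_comult[OF assms] .

lemma comult_eq_sw: "coalgebra C \<Longrightarrow> x \<in> carrier C \<Longrightarrow> comult C x = sw C x (pure C C)"
  using sweedler_rep(2)[OF coalgebraD(4)] by (simp add: sw_def)

lemma sw_eq_of_comult_eq:
  assumes C: "coalgebra C" "x \<in> carrier C" and W: "vspace W" "bilin C C W b"
    and eq: "comult C x = (\<Sum>(u, v)\<leftarrow>xs. pure C C u v)" "set xs \<subseteq> carrier C \<times> carrier C"
  shows "sw C x b = (\<Sum>(u, v)\<leftarrow>xs. b u v)"
  using tensor_lift_sum[OF W eq(2)] tensor_lift_comult[OF C(1) W C(2)] eq(1) by simp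

text \<open>The lists chosen for \<open>x\<close>, \<open>y\<close> and \<open>x + y\<close> are
  unrelated, so linearity in the split element has to pass through the lift of \<open>b\<close>,
  where the choice disappears. This is where bilinearity of \<open>b\<close> enters;
  \<open>linmap_sw_inside\<close> treats the other dependence, with the split element fixed.\<close>

lemma linmap_sw:
  assumes C: "coalgebra C" and W: "vspace W" and b: "bilin C C W b" and f: "linmap U C f"
  shows "linmap U W (\<lambda>x. sw C (f x) b)"
proof -
  have "linmap C W (\<lambda>x. tensor_lift C C b (comult C x))"
    by (rule linmap_compose[OF linmap_tensor_lift[OF coalgebraD(1)[OF C] W b] coalgebraD(2)[OF C]])
  then have "linmap C W (\<lambda>x. sw C x b)"
    using tensor_lift_comult[OF C W b] coalgebraD(1)[OF C]
    by (auto simp: linmap_def vspaceD smult_closed)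
  from linmap_compose[OF this f] show ?thesis .
qed

text \<open>By cocommutativity the list with exchanged entries is a second representation of the
  same coproduct, and a bilinear map does not distinguish representations.\<close>

lemma sw_cocommute:
  assumes "coalgebra C" "x \<in> carrier C" "cocommutative C" "vspace W" "bilin C C W b"
  shows "sw C x b = sw C x (\<lambda>u v. b v u)"
proof -
  note C = assms(1,2) and W = assms(4)
  have b': "bilin C C W (\<lambda>u v. b v u)" using assms(5) by (simp add: bilin_def)
  have flip: "bilin C C (tensor C C) (\<lambda>u v. pure C C v u)"
    using bilin_pure[of C C] by (simp add: bilin_def)
  have T: "vspace (tensor C C)" by (rule vspace_tensor[OF coalgebraD(1)[OF C(1)]])
  have "comult C x = tensor_flip C C (comult C x)" using assms(2,3) by (simp add: cocommutative_def)
  also have "\<dots> = sw C x (\<lambda>u v. pure C C v u)"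
    unfolding tensor_flip_def by (rule tensor_lift_comult[OF C(1) T flip C(2)])
  also have "\<dots> = (\<Sum>(u, v)\<leftarrow>map (\<lambda>(u, v). (v, u)) (sweedler_rep C x). pure C C u v)"
    unfolding sw_def by (simp add: case_prod_unfold o_def)
  finally have "sw C x b = (\<Sum>(u, v)\<leftarrow>map (\<lambda>(u, v). (v, u)) (sweedler_rep C x). b u v)"
    using sweedler_rep(1)[of C x] by (intro sw_eq_of_comult_eq[OF C W assms(5)]) auto
  then show ?thesis unfolding sw_def by (simp add: case_prod_unfold o_def)
qed

lemma sw_counit:
  assumes "coalgebra C" "x \<in> carrier C"
  shows "sw C x (\<lambda>u v. smult C (counit C u) v) = x"
    and "sw C x (\<lambda>u v. smult C (counit C v) u) = x"
proof -
  note C = coalgebraD[OF assms(1)]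
  have "bilin C C C (\<lambda>u v. smult C (counit C u) v)" "bilin C C C (\<lambda>u v. smult C (counit C v) u)"
    by (intro bilinI linmap_smult linmap_smult_left linmap_id C; assumption)+
  from this[THEN sweedler_eq_sw[OF assms(1) C(1) _ assms(2)]]
  show "sw C x (\<lambda>u v. smult C (counit C u) v) = x" "sw C x (\<lambda>u v. smult C (counit C v) u) = x"
    using assms by (simp_all add: coalgebra_def)
qed

lemma sw_counit_linmap:
  assumes "coalgebra C" "x \<in> carrier C" "vspace W" "linmap C W f"
  shows "sw C x (\<lambda>u v. smult W (counit C u) (f v)) = f x"
    and "sw C x (\<lambda>u v. smult W (counit C v) (f u)) = f x"
proof -
  note C = coalgebraD(1)[OF assms(1)]
  have "f x = f (sw C x (\<lambda>u v. smult C (counit C u) v))" using sw_counit(1)[OF assms(1,2)] by simp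
  also have "\<dots> = sw C x (\<lambda>u v. smult W (counit C u) (f v))"
    by (subst linmap_sw_outside[OF C assms(4)]) (simp_all add: smult_closed C linmapD[OF assms(4)])
  finally show "sw C x (\<lambda>u v. smult W (counit C u) (f v)) = f x" ..
  have "f x = f (sw C x (\<lambda>u v. smult C (counit C v) u))" using sw_counit(2)[OF assms(1,2)] by simp
  also have "\<dots> = sw C x (\<lambda>u v. smult W (counit C v) (f u))"
    by (subst linmap_sw_outside[OF C assms(4)]) (simp_all add: smult_closed C linmapD[OF assms(4)])
  finally show "sw C x (\<lambda>u v. smult W (counit C v) (f u)) = f x" ..
qed

text \<open>The axiom is an equation in C \<otimes> (C \<otimes> C). A trilinear \<open>t\<close>
  factors through that space, so applying the induced linear map to both sides of the axiom gives
  the identity for \<open>t\<close>.\<close>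

lemma sw_coassoc:
  assumes C: "coalgebra C" "x \<in> carrier C" and W: "vspace W"
    and t1: "\<And>b c. b \<in> carrier C \<Longrightarrow> c \<in> carrier C \<Longrightarrow> linmap C W (\<lambda>a. t a b c)"
    and t2: "\<And>a c. a \<in> carrier C \<Longrightarrow> c \<in> carrier C \<Longrightarrow> linmap C W (\<lambda>b. t a b c)"
    and t3: "\<And>a b. a \<in> carrier C \<Longrightarrow> b \<in> carrier C \<Longrightarrow> linmap C W (\<lambda>c. t a b c)"
  shows "sw C x (\<lambda>p c. sw C p (\<lambda>a b. t a b c)) = sw C x (\<lambda>a q. sw C q (\<lambda>b c. t a b c))"
proof -
  note V = coalgebraD(1)[OF C(1)]
  let ?CC = "tensor C C" and ?C3 = "tensor C (tensor C C)"
  have vs: "vspace ?CC" "vspace ?C3" "vspace (tensor ?CC C)"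
    by (simp_all add: vspace_tensor V)
  note pl = linmap_bilin_left[OF bilin_pure] and pr = linmap_bilin_right[OF bilin_pure]
  have pc: "pure C C a b \<in> carrier ?CC" if "a \<in> carrier C" "b \<in> carrier C" for a b
    using bilinD(1)[OF bilin_pure that] .
  have bt: "bilin C C W (t a)" if "a \<in> carrier C" for a using t2 t3 that by (intro bilinI)
  have lt: "linmap C W (\<lambda>a. tensor_lift C C (t a) s)" if s: "s \<in> carrier ?CC" for s
    using V W bt t1 s by (rule linmap_tensor_lift_inside)
  have bT: "bilin C ?CC W (\<lambda>a s. tensor_lift C C (t a) s)"
    using lt by (intro bilinI linmap_tensor_lift[OF V W bt])
  \<comment> \<open>Lifting twice, first in the last two arguments and then in the first, turns the
    trilinear \<open>t\<close> into a linear map on the triple tensor product.\<close>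
  let ?\<Phi> = "tensor_lift C ?CC (\<lambda>a s. tensor_lift C C (t a) s)"
  have \<Phi>: "linmap ?C3 W ?\<Phi>" by (rule linmap_tensor_lift[OF V W bT])
  have \<Phi>p: "?\<Phi> (pure C ?CC a (pure C C b c)) = t a b c"
    if "a \<in> carrier C" "b \<in> carrier C" "c \<in> carrier C" for a b c
    using that tensor_lift_pure[OF W bT that(1) pc] tensor_lift_pure[OF W bt] by simp
  have pcl: "pure C ?CC a (pure C C b c) \<in> carrier ?C3"
    if "a \<in> carrier C" "b \<in> carrier C" "c \<in> carrier C" for a b c
    using bilinD(1)[OF bilin_pure that(1) pc[OF that(2,3)]] .
  have bq: "bilin C C ?C3 (\<lambda>u v. pure C ?CC u (pure C C v w))" if "w \<in> carrier C" for w
    using that by (intro bilinI pl pr linmap_id pc)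
  have la: "linmap C ?C3 (\<lambda>w. tensor_lift C C (\<lambda>u v. pure C ?CC u (pure C C v w)) s)"
    if s: "s \<in> carrier ?CC" for s
    by (rule linmap_tensor_lift_inside[OF V vs(2) bq _ s]) (assumption | intro pr linmap_id)+
  have ba: "bilin ?CC C ?C3 (\<lambda>s w. tensor_lift C C (\<lambda>u v. pure C ?CC u (pure C C v w)) s)"
    by (intro bilinI la linmap_tensor_lift[OF V vs(2) bq])
  have as: "linmap (tensor ?CC C) ?C3 (tensor_assoc C C C)"
    unfolding tensor_assoc_def by (rule linmap_tensor_lift[OF vs(1,2) ba])
  have b1: "bilin C C (tensor ?CC C) (\<lambda>u v. pure ?CC C (comult C u) v)"
    by (intro bilinI pl pr coalgebraD[OF C(1)] linmap_id)
  have b2: "bilin C C ?C3 (\<lambda>u v. pure C ?CC u (comult C v))"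
    by (intro bilinI pl pr coalgebraD[OF C(1)] linmap_id)
  have cm: "comult C u \<in> carrier ?CC" if "u \<in> carrier C" for u by (rule coalgebraD(4)[OF C(1) that])
  have L: "tensor_assoc C C C (tensor_map C C ?CC C (comult C) id (comult C x)) =
      sw C x (\<lambda>p c. sw C p (\<lambda>a b. pure C ?CC a (pure C C b c)))" (is "?l = _")
  proof -
    have "?l = tensor_assoc C C C (sw C x (\<lambda>u v. pure ?CC C (comult C u) v))"
      unfolding tensor_map_def id_def by (subst tensor_lift_comult[OF C(1) vs(3) b1 C(2)]) simp
    also have "\<dots> = sw C x (\<lambda>u v. tensor_assoc C C C (pure ?CC C (comult C u) v))"
      using cm bilinD(1)[OF bilin_pure] by (intro linmap_sw_outside[OF vs(3) as]) blast
    also have "\<dots> = sw C x (\<lambda>p c. sw C p (\<lambda>a b. pure C ?CC a (pure C C b c)))"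
      unfolding tensor_assoc_def
      by (intro sw_cong refl, subst tensor_lift_pure[OF vs(2) ba cm], assumption+)
        (simp add: tensor_lift_comult[OF C(1) vs(2) bq])
    finally show ?thesis .
  qed
  have R: "tensor_map C C C ?CC id (comult C) (comult C x) =
      sw C x (\<lambda>a q. sw C q (\<lambda>b c. pure C ?CC a (pure C C b c)))" (is "?r = _")
  proof -
    have "?r = sw C x (\<lambda>u v. pure C ?CC u (comult C v))"
      unfolding tensor_map_def id_def by (subst tensor_lift_comult[OF C(1) vs(2) b2 C(2)]) simp
    also have "\<dots> = sw C x (\<lambda>a q. sw C q (\<lambda>b c. pure C ?CC a (pure C C b c)))"
    proof (intro sw_cong refl)
      fix a q assume aq: "a \<in> carrier C" "q \<in> carrier C"
      have "linmap ?CC ?C3 (\<lambda>s. pure C ?CC a s)" by (intro pr linmap_id aq)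
      then show "pure C ?CC a (comult C q) = sw C q (\<lambda>b c. pure C ?CC a (pure C C b c))"
        unfolding comult_eq_sw[OF C(1) aq(2)] using pc by (intro linmap_sw_outside[OF vs(1)])
    qed
    finally show ?thesis .
  qed
  have eq: "sw C x (\<lambda>p c. sw C p (\<lambda>a b. pure C ?CC a (pure C C b c))) =
      sw C x (\<lambda>a q. sw C q (\<lambda>b c. pure C ?CC a (pure C C b c)))"
    using C L R by (simp add: coalgebra_def)
  have "sw C x (\<lambda>p c. sw C p (\<lambda>a b. t a b c)) =
      sw C x (\<lambda>p c. sw C p (\<lambda>a b. ?\<Phi> (pure C ?CC a (pure C C b c))))"
    by (simp only: \<Phi>p cong: sw_cong)
  also have "\<dots> = ?\<Phi> (sw C x (\<lambda>p c. sw C p (\<lambda>a b. pure C ?CC a (pure C C b c))))"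
    by (simp add: linmap_sw_outside[OF vs(2) \<Phi>] sw_closed[OF vs(2)] pcl)
  also have "\<dots> = ?\<Phi> (sw C x (\<lambda>a q. sw C q (\<lambda>b c. pure C ?CC a (pure C C b c))))"
    using eq by simp
  also have "\<dots> = sw C x (\<lambda>a q. sw C q (\<lambda>b c. ?\<Phi> (pure C ?CC a (pure C C b c))))"
    by (simp add: linmap_sw_outside[OF vs(2) \<Phi>] sw_closed[OF vs(2)] pcl)
  also have "\<dots> = sw C x (\<lambda>a q. sw C q (\<lambda>b c. t a b c))"
    by (simp only: \<Phi>p cong: sw_cong)
  finally show ?thesis .
qed

text \<open>Rebracketing the fourfold coproduct puts its two middle components into a single
  coproduct, where they may be exchanged. The pairing (a, b), (c, d) thus becomes (a, c), (b,
  d).\<close>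

lemma sw_interchange:
  assumes C: "coalgebra C" "x \<in> carrier C" "cocommutative C" and W: "vspace W"
    and t1: "\<And>b c d. b \<in> carrier C \<Longrightarrow> c \<in> carrier C \<Longrightarrow> d \<in> carrier C \<Longrightarrow> linmap C W (\<lambda>a. t a b c d)"
    and t2: "\<And>a c d. a \<in> carrier C \<Longrightarrow> c \<in> carrier C \<Longrightarrow> d \<in> carrier C \<Longrightarrow> linmap C W (\<lambda>b. t a b c d)"
    and t3: "\<And>a b d. a \<in> carrier C \<Longrightarrow> b \<in> carrier C \<Longrightarrow> d \<in> carrier C \<Longrightarrow> linmap C W (\<lambda>c. t a b c d)"
    and t4: "\<And>a b c. a \<in> carrier C \<Longrightarrow> b \<in> carrier C \<Longrightarrow> c \<in> carrier C \<Longrightarrow> linmap C W (\<lambda>d. t a b c d)"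
  shows "sw C x (\<lambda>p q. sw C p (\<lambda>a b. sw C q (\<lambda>c d. t a b c d))) =
    sw C x (\<lambda>p q. sw C p (\<lambda>a b. sw C q (\<lambda>c d. t a c b d)))"
proof -
  note lin = t1 t2 t3 t4 linmap_id linmap_sw_inside[OF W] linmap_sw[OF C(1) W] bilinI
  \<comment> \<open>Stated for arbitrary \<open>s\<close>, since it is used forwards for
    \<open>t\<close> and backwards for \<open>t\<close> with its middle arguments exchanged.\<close>
  have expand: "sw C x (\<lambda>p q. sw C p (\<lambda>a b. sw C q (\<lambda>c d. s a b c d))) =
      sw C x (\<lambda>a r. sw C r (\<lambda>q d. sw C q (\<lambda>b c. s a b c d)))"
    if s: "\<And>b c d. b \<in> carrier C \<Longrightarrow> c \<in> carrier C \<Longrightarrow> d \<in> carrier C \<Longrightarrow> linmap C W (\<lambda>a. s a b c d)"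
      "\<And>a c d. a \<in> carrier C \<Longrightarrow> c \<in> carrier C \<Longrightarrow> d \<in> carrier C \<Longrightarrow> linmap C W (\<lambda>b. s a b c d)"
      "\<And>a b d. a \<in> carrier C \<Longrightarrow> b \<in> carrier C \<Longrightarrow> d \<in> carrier C \<Longrightarrow> linmap C W (\<lambda>c. s a b c d)"
      "\<And>a b c. a \<in> carrier C \<Longrightarrow> b \<in> carrier C \<Longrightarrow> c \<in> carrier C \<Longrightarrow> linmap C W (\<lambda>d. s a b c d)" for s
  proof -
    note lin = s linmap_id linmap_sw_inside[OF W] linmap_sw[OF C(1) W] bilinI
    have "sw C x (\<lambda>p q. sw C p (\<lambda>a b. sw C q (\<lambda>c d. s a b c d))) =
        sw C x (\<lambda>a r. sw C r (\<lambda>b q. sw C q (\<lambda>c d. s a b c d)))"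
      by (rule sw_coassoc[OF C(1,2) W]) (intro lin; assumption)+
    also have "\<dots> = sw C x (\<lambda>a r. sw C r (\<lambda>q d. sw C q (\<lambda>b c. s a b c d)))"
      by (rule sw_cong[OF refl], rule sw_coassoc[OF C(1) _ W, symmetric]) (assumption | intro lin)+
    finally show ?thesis .
  qed
  have "sw C x (\<lambda>p q. sw C p (\<lambda>a b. sw C q (\<lambda>c d. t a b c d))) =
      sw C x (\<lambda>a r. sw C r (\<lambda>q d. sw C q (\<lambda>b c. t a b c d)))"
    by (rule expand[OF t1 t2 t3 t4])
  also have "\<dots> = sw C x (\<lambda>a r. sw C r (\<lambda>q d. sw C q (\<lambda>b c. t a c b d)))"
    by (rule sw_cong[OF refl], rule sw_cong[OF refl], rule sw_cocommute[OF C(1) _ C(3) W]) (assumption | intro lin)+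
  also have "\<dots> = sw C x (\<lambda>p q. sw C p (\<lambda>a b. sw C q (\<lambda>c d. t a c b d)))"
    by (rule expand[symmetric]) (rule t1 t2 t3 t4; assumption)+
  finally show ?thesis .
qed

section \<open>Coalgebra maps in Sweedler notation\<close>

text \<open>Meant for nested sums: an inner \<open>sweedler\<close> equals its \<open>sw\<close>
  form only for parameters in the carrier, so bilinearity is verified for the rewritten summand
  \<open>b'\<close> and transferred to \<open>b\<close>.\<close>

lemma sweedler_eq_sw_cong:
  assumes "coalgebra C" "vspace W" "bilin C C W b'" "x \<in> carrier C"
    and "\<And>u v. u \<in> carrier C \<Longrightarrow> v \<in> carrier C \<Longrightarrow> b u v = b' u v"
  shows "sweedler C x b = sw C x b'"
proof -
  have "bilin C C W b" using assms(3,5) coalgebraD(1)[OF assms(1)]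
    by (auto simp: bilin_def linmap_def vspaceD smult_closed)
  from sweedler_eq_sw[OF assms(1,2) this assms(4)] show ?thesis using assms(5) by simp
qed

text \<open>This shape covers the comultiplication of \<open>tensor_coalg\<close>, where all three
  maps are \<open>pure\<close>, and the coproduct axiom of a modulelike bialgebra, where
  \<open>f\<close> and \<open>g\<close> are the action and \<open>h\<close> is
  \<open>pure\<close>.\<close>

lemma sweedler_sweedler_eq_sw:
  assumes C: "coalgebra C" "c \<in> carrier C" and D: "coalgebra D" "d \<in> carrier D" and W: "vspace W"
    and f: "bilin C D X f" and g: "bilin C D Y g" and h: "bilin X Y W h"
  shows "sweedler C c (\<lambda>c1 c2. sweedler D d (\<lambda>d1 d2. h (f c1 d1) (g c2 d2))) =
    sw C c (\<lambda>c1 c2. sw D d (\<lambda>d1 d2. h (f c1 d1) (g c2 d2)))"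
proof -
  note lin = linmap_bilin_left[OF f] linmap_bilin_right[OF f] linmap_bilin_left[OF g]
    linmap_bilin_right[OF g] linmap_bilin_left[OF h] linmap_bilin_right[OF h] linmap_id
    bilinI linmap_sw_inside[OF W] bilinD(1)[OF f] bilinD(1)[OF g]
  show ?thesis
  proof (rule sweedler_eq_sw_cong[OF C(1) W _ C(2)])
    show "bilin C C W (\<lambda>c1 c2. sw D d (\<lambda>d1 d2. h (f c1 d1) (g c2 d2)))"
      by (intro lin; assumption)
    fix u v assume "u \<in> carrier C" "v \<in> carrier C"
    then show "sweedler D d (\<lambda>d1 d2. h (f u d1) (g v d2)) = sw D d (\<lambda>d1 d2. h (f u d1) (g v d2))"
      by (intro sweedler_eq_sw[OF D(1) W _ D(2)] lin)
  qed
qed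

lemma bilin_sw_sw:
  assumes C: "coalgebra C" and D: "coalgebra D" and W: "vspace W"
    and f: "bilin C D X f" and g: "bilin C D Y g" and h: "bilin X Y W h"
  shows "bilin C D W (\<lambda>c d. sw C c (\<lambda>c1 c2. sw D d (\<lambda>d1 d2. h (f c1 d1) (g c2 d2))))"
proof -
  note lin = linmap_bilin_left[OF f] linmap_bilin_right[OF f] linmap_bilin_left[OF g]
    linmap_bilin_right[OF g] linmap_bilin_left[OF h] linmap_bilin_right[OF h] linmap_id
    bilinI linmap_sw_inside[OF W] linmap_sw[OF C W] linmap_sw[OF D W] bilinD(1)[OF f] bilinD(1)[OF g]
  show ?thesis by (intro lin; assumption)
qed

text \<open>The two records have different types but the same carrier and scalars, and linearity,
  pure tensors and lifts depend on these alone. Everything can thus be computed over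
  \<open>tensor C D\<close>.\<close>

lemma tensor_coalg_simps [simp]:
  "linmap (tensor_coalg C D) = linmap (tensor C D)"
  "pure (tensor_coalg C D) (tensor_coalg C D) = pure (tensor C D) (tensor C D)"
  "tensor_lift (tensor_coalg C D) (tensor_coalg C D) = tensor_lift (tensor C D) (tensor C D)"
  "carrier (tensor_coalg C D) = carrier (tensor C D)"
  by (auto simp: fun_eq_iff linmap_def pure_def bilin_def tensor_coalg_def tensor_lift_def)

text \<open>Both sides are linear in \<open>t\<close>, so uniqueness of the lift leaves only pure
  tensors to compare. The result turns the abstract condition on coproducts into an identity between
  elements.\<close>

lemma tensor_map_comult_tensor_coalg:
  assumes C: "coalgebra C" and D: "coalgebra D" and E: "vspace E" and b: "bilin C D E b"
    and t: "t \<in> carrier (tensor C D)"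
  shows "tensor_map (tensor_coalg C D) (tensor_coalg C D) E E (tensor_lift C D b) (tensor_lift C D b)
      (comult (tensor_coalg C D) t) =
    tensor_lift C D (\<lambda>c d. sw C c (\<lambda>c1 c2. sw D d (\<lambda>d1 d2. pure E E (b c1 d1) (b c2 d2)))) t"
proof -
  let ?T = "tensor C D"
  note V = coalgebraD(1)[OF C] coalgebraD(1)[OF D]
  have vs: "vspace ?T" "vspace (tensor ?T ?T)" "vspace (tensor E E)"
    by (simp_all add: vspace_tensor V E)
  let ?F = "\<lambda>c d. sweedler C c (\<lambda>c1 c2. sweedler D d (\<lambda>d1 d2. pure ?T ?T (pure C D c1 d1) (pure C D c2 d2)))"
  let ?F' = "\<lambda>c d. sw C c (\<lambda>c1 c2. sw D d (\<lambda>d1 d2. pure ?T ?T (pure C D c1 d1) (pure C D c2 d2)))"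
  have FF': "?F c d = ?F' c d" if "c \<in> carrier C" "d \<in> carrier D" for c d
    by (rule sweedler_sweedler_eq_sw[OF C that(1) D that(2) vs(2) bilin_pure bilin_pure bilin_pure])
  have "bilin C D (tensor ?T ?T) ?F'"
    by (rule bilin_sw_sw[OF C D vs(2) bilin_pure bilin_pure bilin_pure])
  then have F: "bilin C D (tensor ?T ?T) ?F" using FF' V
    by (auto simp: bilin_def linmap_def vspaceD smult_closed)
  let ?G = "\<lambda>c d. sw C c (\<lambda>c1 c2. sw D d (\<lambda>d1 d2. pure E E (b c1 d1) (b c2 d2)))"
  have G: "bilin C D (tensor E E) ?G" by (rule bilin_sw_sw[OF C D vs(3) b b bilin_pure])
  have L: "linmap ?T E (tensor_lift C D b)" by (rule linmap_tensor_lift[OF V(1) E b])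
  have LL: "bilin ?T ?T (tensor E E) (\<lambda>u v. pure E E (tensor_lift C D b u) (tensor_lift C D b v))"
    by (intro bilinI linmap_bilin_left[OF bilin_pure] linmap_bilin_right[OF bilin_pure] L linmapD(1)[OF L]; assumption)
  have M: "linmap (tensor ?T ?T) (tensor E E) (tensor_lift ?T ?T
      (\<lambda>u v. pure E E (tensor_lift C D b u) (tensor_lift C D b v)))" (is "linmap _ _ ?M")
    by (rule linmap_tensor_lift[OF vs(1,3) LL])
  have pT: "pure C D c d \<in> carrier ?T" if "c \<in> carrier C" "d \<in> carrier D" for c d
    using bilinD(1)[OF bilin_pure that] .
  have pTT: "pure ?T ?T u v \<in> carrier (tensor ?T ?T)" if "u \<in> carrier ?T" "v \<in> carrier ?T" for u v
    using bilinD(1)[OF bilin_pure that] .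
  have "?M (tensor_lift C D ?F t) = tensor_lift C D ?G t"
  proof (rule tensor_lift_unique[OF V(1) vs(3) G _ _ t])
    show "linmap ?T (tensor E E) (\<lambda>t. ?M (tensor_lift C D ?F t))"
      by (rule linmap_compose[OF M linmap_tensor_lift[OF V(1) vs(2) F]])
    fix u v assume uv: "u \<in> carrier C" "v \<in> carrier D"
    have "?M (tensor_lift C D ?F (pure C D u v)) = ?M (?F' u v)"
      by (simp add: tensor_lift_pure[OF vs(2) F uv] FF'[OF uv])
    also have "\<dots> = ?G u v"
      by (simp add: linmap_sw_outside[OF vs(2) M] sw_closed[OF vs(2)] pT pTT
        tensor_lift_pure[OF vs(3) LL] tensor_lift_pure[OF E b])
    finally show "?M (tensor_lift C D ?F (pure C D u v)) = ?G u v" .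
  qed
  then show ?thesis by (simp add: tensor_map_def) (simp add: tensor_coalg_def)
qed

section \<open>Bilinear coalgebra maps through their values on pure tensors\<close>

lemma bilin_coalg_homD:
  assumes C: "coalgebra C" and D: "coalgebra D" and E: "coalgebra E" and b: "bilin_coalg_hom C D E b"
  shows "bilin C D E b"
    and "x \<in> carrier C \<Longrightarrow> y \<in> carrier D \<Longrightarrow>
      comult E (b x y) = sw C x (\<lambda>x1 x2. sw D y (\<lambda>y1 y2. pure E E (b x1 y1) (b x2 y2)))"
    and "x \<in> carrier C \<Longrightarrow> y \<in> carrier D \<Longrightarrow> counit E (b x y) = counit C x * counit D y"
proof -
  show b1: "bilin C D E b" using b by (simp add: bilin_coalg_hom_def)
  note V = coalgebraD(1)[OF C] coalgebraD(1)[OF D] coalgebraD(1)[OF E]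
  assume xy: "x \<in> carrier C" "y \<in> carrier D"
  let ?T = "tensor C D"
  have p: "pure C D x y \<in> carrier ?T" using bilinD(1)[OF bilin_pure xy] .
  have G: "bilin C D (tensor E E)
      (\<lambda>c d. sw C c (\<lambda>c1 c2. sw D d (\<lambda>d1 d2. pure E E (b c1 d1) (b c2 d2))))"
    by (rule bilin_sw_sw[OF C D vspace_tensor[OF V(3)] b1 b1 bilin_pure])
  have h: "coalg_hom (tensor_coalg C D) E (tensor_lift C D b)" using b by (simp add: bilin_coalg_hom_def)
  have "comult E (tensor_lift C D b (pure C D x y)) = tensor_map (tensor_coalg C D) (tensor_coalg C D)
     E E (tensor_lift C D b) (tensor_lift C D b) (comult (tensor_coalg C D) (pure C D x y))"
    using h p by (simp add: coalg_hom_def)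
  then show "comult E (b x y) = sw C x (\<lambda>x1 x2. sw D y (\<lambda>y1 y2. pure E E (b x1 y1) (b x2 y2)))"
    unfolding tensor_map_comult_tensor_coalg[OF C D V(3) b1 p] tensor_lift_pure[OF V(3) b1 xy]
      tensor_lift_pure[OF vspace_tensor[OF V(3)] G xy] .
  have "bilin C D base (\<lambda>c d. counit C c * counit D d)"
    using coalgebraD(3)[OF C] coalgebraD(3)[OF D]
    by (auto simp: bilin_def linmap_def base_def algebra_simps)
  then show "counit E (b x y) = counit C x * counit D y"
    using h p tensor_lift_pure[OF V(3) b1 xy]
      tensor_lift_pure[OF vspace_base _ xy, of "\<lambda>c d. counit C c * counit D d"]
    by (auto simp: coalg_hom_def tensor_coalg_def)
qed

text \<open>Linear maps out of C \<otimes> D that agree on pure tensors are equal, so the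
  elementwise identities for coproduct and counit already give a coalgebra map.\<close>

lemma bilin_coalg_homI:
  assumes C: "coalgebra C" and D: "coalgebra D" and E: "coalgebra E" and b: "bilin C D E b"
    and \<Delta>: "\<And>x y. x \<in> carrier C \<Longrightarrow> y \<in> carrier D \<Longrightarrow>
      comult E (b x y) = sw C x (\<lambda>x1 x2. sw D y (\<lambda>y1 y2. pure E E (b x1 y1) (b x2 y2)))"
    and \<epsilon>: "\<And>x y. x \<in> carrier C \<Longrightarrow> y \<in> carrier D \<Longrightarrow> counit E (b x y) = counit C x * counit D y"
  shows "bilin_coalg_hom C D E b"
  unfolding bilin_coalg_hom_def coalg_hom_def
proof (intro conjI ballI b)
  note V = coalgebraD(1)[OF C] coalgebraD(1)[OF D] coalgebraD(1)[OF E]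
  note L = linmap_tensor_lift[OF V(1,3) b]
  show "linmap (tensor_coalg C D) E (tensor_lift C D b)" using L by simp
  fix t assume "t \<in> carrier (tensor_coalg C D)"
  then have t: "t \<in> carrier (tensor C D)" by simp
  have G: "bilin C D (tensor E E)
      (\<lambda>c d. sw C c (\<lambda>c1 c2. sw D d (\<lambda>d1 d2. pure E E (b c1 d1) (b c2 d2))))"
    by (rule bilin_sw_sw[OF C D vspace_tensor[OF V(3)] b b bilin_pure])
  show "comult E (tensor_lift C D b t) = tensor_map (tensor_coalg C D) (tensor_coalg C D)
     E E (tensor_lift C D b) (tensor_lift C D b) (comult (tensor_coalg C D) t)"
    unfolding tensor_map_comult_tensor_coalg[OF C D V(3) b t]
    using t by (intro tensor_lift_unique[OF V(1) vspace_tensor[OF V(3)] G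
        linmap_compose[OF coalgebraD(2)[OF E] L]]) (simp_all add: \<Delta> tensor_lift_pure[OF V(3) b])
  have c: "bilin C D base (\<lambda>c d. counit C c * counit D d)"
    using coalgebraD(3)[OF C] coalgebraD(3)[OF D]
    by (auto simp: bilin_def linmap_def base_def algebra_simps)
  have "counit E (tensor_lift C D b t) = tensor_lift C D (\<lambda>c d. counit C c * counit D d) t"
    using t by (intro tensor_lift_unique[OF V(1) vspace_base c
        linmap_compose[OF coalgebraD(3)[OF E] L]]) (simp_all add: \<epsilon> tensor_lift_pure[OF V(3) b])
  then show "counit E (tensor_lift C D b t) = counit (tensor_coalg C D) t"
    by (simp add: tensor_coalg_def)
qed

text \<open>Applying the lift of \<open>f\<close> to the formula for the coproduct of
  \<open>b x y\<close> replaces its components by the values of \<open>b\<close> on components of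
  \<open>x\<close> and \<open>y\<close>. It serves for the action and later for the star product
  itself.\<close>

lemma sw_bilin_coalg_hom:
  assumes C: "coalgebra C" and D: "coalgebra D" and E: "coalgebra E" and b: "bilin_coalg_hom C D E b"
    and W: "vspace W" "bilin E E W f" and xy: "x \<in> carrier C" "y \<in> carrier D"
  shows "sw E (b x y) f = sw C x (\<lambda>x1 x2. sw D y (\<lambda>y1 y2. f (b x1 y1) (b x2 y2)))"
proof -
  note h = bilin_coalg_homD[OF C D E b]
  have L: "linmap (tensor E E) W (tensor_lift E E f)"
    by (rule linmap_tensor_lift[OF coalgebraD(1)[OF E] W])
  have T: "vspace (tensor E E)" by (rule vspace_tensor[OF coalgebraD(1)[OF E]])
  have "sw E (b x y) f = tensor_lift E E f (comult E (b x y))"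
    by (rule tensor_lift_comult[OF E W bilinD(1)[OF h(1) xy], symmetric])
  also have "\<dots> = sw C x (\<lambda>x1 x2. sw D y (\<lambda>y1 y2. f (b x1 y1) (b x2 y2)))"
    unfolding h(2)[OF xy]
    by (simp add: linmap_sw_outside[OF T L] sw_closed[OF T] bilinD(1)[OF bilin_pure]
      bilinD(1)[OF h(1)] tensor_lift_pure[OF W])
  finally show ?thesis .
qed

lemma linmap_cong:
  "vspace U \<Longrightarrow> (\<And>x. x \<in> carrier U \<Longrightarrow> f x = g x) \<Longrightarrow> linmap U V f \<longleftrightarrow> linmap U V g"
  by (auto simp: linmap_def vspaceD smult_closed)

lemma bilin_cong:
  assumes "vspace U" "vspace V" "\<And>u v. u \<in> carrier U \<Longrightarrow> v \<in> carrier V \<Longrightarrow> f u v = g u v"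
  shows "bilin U V W f \<longleftrightarrow> bilin U V W g"
  using assms by (auto simp: bilin_def linmap_def vspaceD smult_closed)

lemma bilin_sw_left:
  assumes "bilin U V W f" "vspace U" "v \<in> carrier V"
    and "\<And>a b. a \<in> carrier C \<Longrightarrow> b \<in> carrier C \<Longrightarrow> g a b \<in> carrier U"
  shows "f (sw C x g) v = sw C x (\<lambda>a b. f (g a b) v)"
  by (rule linmap_sw_outside[OF assms(2) linmap_bilin_left[OF assms(1) linmap_id assms(3)] assms(4)])

lemma bilin_sw_right:
  assumes "bilin U V W f" "vspace V" "u \<in> carrier U"
    and "\<And>a b. a \<in> carrier C \<Longrightarrow> b \<in> carrier C \<Longrightarrow> g a b \<in> carrier V"
  shows "f u (sw C x g) = sw C x (\<lambda>a b. f u (g a b))"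
  by (rule linmap_sw_outside[OF assms(2) linmap_bilin_right[OF assms(1,3) linmap_id] assms(4)])

section \<open>The sub-adjacent Hopf group-algebra\<close>

locale cocommutative_post_hopf_pi_algebra = post_hopf_pi_algebra +
  assumes cocomm: "cocommutative (H \<alpha>)"
begin

abbreviation psi where "psi \<alpha> \<beta> \<equiv> conv_inverse (H \<alpha>) (H \<beta>) (act \<alpha> \<beta>)"
abbreviation star where "star \<equiv> star_mul H mul act"
abbreviation T where "T \<equiv> star_antipode H S act"

section \<open>Bookkeeping of degrees, carriers and linearity\<close>

lemma vs [simp]: "vspace (H \<alpha>)"
  using coalgebraD(1)[OF coalg] .

text \<open>Degrees such as \<open>- \<alpha> + (\<alpha> + \<delta>)\<close> and
  \<open>\<delta>\<close> are equal without being syntactically equal. A free target degree with an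
  equation as premise lets the rule match and leaves the group identity to the simplifier.\<close>

lemma mul_bilin: "\<gamma> = \<alpha> + \<beta> \<Longrightarrow> bilin (H \<alpha>) (H \<beta>) (H \<gamma>) (mul \<alpha> \<beta>)"
  using bilin_coalg_homD(1)[OF coalg coalg coalg mul_hom] by simp

lemma act_bilin: "bilin (H \<alpha>) (H \<beta>) (H \<beta>) (act \<alpha> \<beta>)"
  using bilin_coalg_homD(1)[OF coalg coalg coalg act_hom] .

lemma psi_conv_inverse: "conv_inverse_of (H \<alpha>) (H \<beta>) (act \<alpha> \<beta>) (psi \<alpha> \<beta>)"
  unfolding conv_inverse_def using theI'[OF act_conv_invertible] .

lemma psi_bilin: "bilin (H \<alpha>) (H \<beta>) (H \<beta>) (psi \<alpha> \<beta>)"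
  using psi_conv_inverse by (simp add: conv_inverse_of_def)

lemma S_linear: "\<beta> = - \<alpha> \<Longrightarrow> linmap (H \<alpha>) (H \<beta>) (S \<alpha>)"
  using antipode_linear by simp

lemma linmap_H_id: "\<alpha> = \<beta> \<Longrightarrow> linmap (H \<alpha>) (H \<beta>) (\<lambda>x. x)"
  by (simp add: linmap_id)

lemmas closed = bilinD(1)[OF mul_bilin] bilinD(1)[OF act_bilin] bilinD(1)[OF psi_bilin]
  linmapD(1)[OF S_linear] sw_closed[OF vs] smult_closed[OF vs] one_closed

text \<open>Applied along the syntax of a nested sum, these rules reduce its linearity in one
  variable to carrier membership and identities between degrees.\<close>

lemmas lin = linmap_H_id bilinI linmap_sw_inside linmap_sw linmap_smult linmap_smult_left
  linmap_compose[OF coalgebraD(3)[OF coalg]] linmap_compose[OF S_linear]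
  linmap_bilin_left[OF mul_bilin] linmap_bilin_right[OF mul_bilin]
  linmap_bilin_left[OF act_bilin] linmap_bilin_right[OF act_bilin]
  linmap_bilin_left[OF psi_bilin] linmap_bilin_right[OF psi_bilin]

text \<open>Oriented to move sums outwards through every operation, so that calculations compare
  iterated sums of plain monomials.\<close>

lemmas pull = bilin_sw_left[OF mul_bilin[OF refl] vs] bilin_sw_right[OF mul_bilin[OF refl] vs]
  bilin_sw_left[OF act_bilin vs] bilin_sw_right[OF act_bilin vs]
  bilin_sw_left[OF psi_bilin vs] bilin_sw_right[OF psi_bilin vs]

lemmas scale = bilinD(4,5)[OF mul_bilin[OF refl]] bilinD(4,5)[OF act_bilin] bilinD(4,5)[OF psi_bilin]

lemma act_mul_sw:
  assumes "x \<in> carrier (H \<alpha>)" "y \<in> carrier (H \<beta>)" "z \<in> carrier (H \<gamma>)" "\<delta> = \<beta> + \<gamma>"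
  shows "act \<alpha> \<delta> x (mul \<beta> \<gamma> y z) =
    sw (H \<alpha>) x (\<lambda>x1 x2. mul \<beta> \<gamma> (act \<alpha> \<beta> x1 y) (act \<alpha> \<gamma> x2 z))"
  unfolding assms(4) act_mul[OF assms(1-3)]
  by (rule sweedler_eq_sw[of _ "H (\<beta> + \<gamma>)"]) (rule lin refl | simp add: closed assms coalg)+

lemma star_sw:
  assumes "x \<in> carrier (H \<alpha>)" "y \<in> carrier (H \<beta>)"
  shows "star \<alpha> \<beta> x y = sw (H \<alpha>) x (\<lambda>x1 x2. mul \<alpha> \<beta> x1 (act \<alpha> \<beta> x2 y))"
  unfolding star_mul_def
  by (rule sweedler_eq_sw[of _ "H (\<alpha> + \<beta>)"]) (rule lin refl | simp add: closed assms coalg)+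

lemma star_bilin: "\<gamma> = \<alpha> + \<beta> \<Longrightarrow> bilin (H \<alpha>) (H \<beta>) (H \<gamma>) (star \<alpha> \<beta>)"
proof -
  assume "\<gamma> = \<alpha> + \<beta>"
  moreover have "bilin (H \<alpha>) (H \<beta>) (H (\<alpha> + \<beta>)) (\<lambda>x y. sw (H \<alpha>) x (\<lambda>x1 x2. mul \<alpha> \<beta> x1 (act \<alpha> \<beta> x2 y)))"
    by (rule lin refl | simp add: closed coalg)+
  ultimately show ?thesis by (simp add: star_sw bilin_cong[OF vs vs, where f = "star \<alpha> \<beta>"])
qed

text \<open>The right-hand side of the axiom \<open>act_act\<close> already contains the star
  product; the axiom says that \<triangleright> is an action for it.\<close>

lemma act_act_star:
  "\<lbrakk>x \<in> carrier (H \<alpha>); y \<in> carrier (H \<beta>); z \<in> carrier (H \<gamma>); \<delta> = \<alpha> + \<beta>\<rbrakk> \<Longrightarrow>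
    act \<delta> \<gamma> (star \<alpha> \<beta> x y) z = act \<alpha> \<gamma> x (act \<beta> \<gamma> y z)"
  using act_act unfolding star_mul_def by simp

lemma antipode_left_sw:
  assumes "x \<in> carrier (H \<alpha>)"
  shows "sw (H \<alpha>) x (\<lambda>x1 x2. mul (- \<alpha>) \<alpha> (S \<alpha> x1) x2) = smult (H 0) (counit (H \<alpha>) x) one"
  unfolding antipode_left[OF assms, symmetric]
  by (rule sweedler_eq_sw[of _ "H 0", symmetric]) (rule lin refl | simp add: closed assms coalg)+

lemma antipode_right_sw:
  assumes "x \<in> carrier (H \<alpha>)"
  shows "sw (H \<alpha>) x (\<lambda>x1 x2. mul \<alpha> (- \<alpha>) x1 (S \<alpha> x2)) = smult (H 0) (counit (H \<alpha>) x) one"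
  unfolding antipode_right[OF assms, symmetric]
  by (rule sweedler_eq_sw[of _ "H 0", symmetric]) (rule lin refl | simp add: closed assms coalg)+

lemma psi_act:
  assumes "x \<in> carrier (H \<alpha>)" "y \<in> carrier (H \<beta>)"
  shows "sw (H \<alpha>) x (\<lambda>x1 x2. psi \<alpha> \<beta> x1 (act \<alpha> \<beta> x2 y)) = smult (H \<beta>) (counit (H \<alpha>) x) y"
    and "sw (H \<alpha>) x (\<lambda>x1 x2. act \<alpha> \<beta> x1 (psi \<alpha> \<beta> x2 y)) = smult (H \<beta>) (counit (H \<alpha>) x) y"
proof -
  have "sweedler (H \<alpha>) x (\<lambda>x1 x2. psi \<alpha> \<beta> x1 (act \<alpha> \<beta> x2 y)) =
      sw (H \<alpha>) x (\<lambda>x1 x2. psi \<alpha> \<beta> x1 (act \<alpha> \<beta> x2 y))"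
    by (rule sweedler_eq_sw[of _ "H \<beta>"]) (rule lin refl | simp add: closed assms coalg)+
  moreover have "sweedler (H \<alpha>) x (\<lambda>x1 x2. act \<alpha> \<beta> x1 (psi \<alpha> \<beta> x2 y)) =
      sw (H \<alpha>) x (\<lambda>x1 x2. act \<alpha> \<beta> x1 (psi \<alpha> \<beta> x2 y))"
    by (rule sweedler_eq_sw[of _ "H \<beta>"]) (rule lin refl | simp add: closed assms coalg)+
  ultimately show "sw (H \<alpha>) x (\<lambda>x1 x2. psi \<alpha> \<beta> x1 (act \<alpha> \<beta> x2 y)) = smult (H \<beta>) (counit (H \<alpha>) x) y"
    and "sw (H \<alpha>) x (\<lambda>x1 x2. act \<alpha> \<beta> x1 (psi \<alpha> \<beta> x2 y)) = smult (H \<beta>) (counit (H \<alpha>) x) y"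
    using psi_conv_inverse assms by (simp_all add: conv_inverse_of_def)
qed

section \<open>The unit: its coproduct, its action and its role in the star product\<close>

lemma comult_one: "comult (H 0) one = pure (H 0) (H 0) one one"
  and counit_one: "counit (H 0) one = 1"
proof -
  have h: "comult (H 0) (smult (H 0) 1 one) = tensor_map base_coalg base_coalg (H 0) (H 0)
      (\<lambda>c. smult (H 0) c one) (\<lambda>c. smult (H 0) c one) (comult base_coalg 1)"
    "counit (H 0) (smult (H 0) 1 one) = counit base_coalg 1"
    using unit_hom by (auto simp: coalg_hom_def base_coalg_def)
  have u: "linmap base_coalg (H 0) (\<lambda>c. smult (H 0) c one)" using unit_hom by (simp add: coalg_hom_def)
  show "counit (H 0) one = 1" using h(2) by (simp add: vspaceD base_coalg_def)
  \<comment> \<open>The unit coalgebra is written with \<open>base\<close> in its coproduct and with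
    \<open>base_coalg\<close> as source of the unit map; the two kinds of pure tensors have to be
    identified.\<close>
  have p: "pure base base = pure (base_coalg :: ('b, 'b) coalg) (base_coalg :: ('b, 'b) coalg)"
    by (auto simp: fun_eq_iff pure_def bilin_def linmap_def base_def base_coalg_def)
  have "bilin (base_coalg :: ('b, 'b) coalg) base_coalg (tensor (H 0) (H 0))
      (\<lambda>u v. pure (H 0) (H 0) (smult (H 0) u one) (smult (H 0) v one))"
    using u by (intro bilinI linmap_bilin_left[OF bilin_pure] linmap_bilin_right[OF bilin_pure])
      (simp_all add: linmapD(1)[OF u])
  from tensor_lift_pure[OF vspace_tensor[OF vs] this, of 1 1]
  have "tensor_map base_coalg base_coalg (H 0) (H 0) (\<lambda>c. smult (H 0) c one) (\<lambda>c. smult (H 0) c one)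
      (pure base_coalg base_coalg 1 1) = pure (H 0) (H 0) (smult (H 0) 1 one) (smult (H 0) 1 one)"
    unfolding tensor_map_def by (simp add: base_coalg_def)
  moreover have "comult base_coalg (1 :: 'b) = pure base_coalg base_coalg 1 1"
    unfolding p[symmetric] by (simp add: base_coalg_def)
  ultimately show "comult (H 0) one = pure (H 0) (H 0) one one"
    using h(1) unfolding vspaceD(7)[OF vs] by simp
qed

lemma sw_one: "vspace W \<Longrightarrow> bilin (H 0) (H 0) W f \<Longrightarrow> sw (H 0) one f = f one one"
  using sw_eq_of_comult_eq[OF coalg one_closed, of W f "[(one, one)]"] comult_one one_closed by simp

lemma counit_mul: "x \<in> carrier (H \<alpha>) \<Longrightarrow> y \<in> carrier (H \<beta>) \<Longrightarrow> \<gamma> = \<alpha> + \<beta> \<Longrightarrow>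
    counit (H \<gamma>) (mul \<alpha> \<beta> x y) = counit (H \<alpha>) x * counit (H \<beta>) y"
  using bilin_coalg_homD(3)[OF coalg coalg coalg mul_hom] by simp

lemma counit_act: "x \<in> carrier (H \<alpha>) \<Longrightarrow> y \<in> carrier (H \<beta>) \<Longrightarrow>
    counit (H \<beta>) (act \<alpha> \<beta> x y) = counit (H \<alpha>) x * counit (H \<beta>) y"
  using bilin_coalg_homD(3)[OF coalg coalg coalg act_hom] .

text \<open>The map \<open>f x = x \<triangleright> 1\<close> is idempotent under convolution, and \<open>S \<circ> f\<close> is its convolution
  inverse since \<open>f\<close> is a coalgebra map; hence \<open>f\<close> is the convolution unit.\<close>

lemma act_unit:
  assumes x: "x \<in> carrier (H \<alpha>)"
  shows "act \<alpha> 0 x one = smult (H 0) (counit (H \<alpha>) x) one"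
proof -
  define f where "f x = act \<alpha> 0 x one" for x
  have f_lin: "linmap (H \<alpha>) (H 0) f" unfolding f_def
    by (rule lin refl | simp add: closed)+
  have f_closed: "f x \<in> carrier (H 0)" if "x \<in> carrier (H \<alpha>)" for x
    using linmapD(1)[OF f_lin that] .
  note lin' = lin linmap_compose[OF f_lin]
  \<comment> \<open>The action is applied to the product of 1 with itself.\<close>
  have f_idem: "sw (H \<alpha>) x (\<lambda>a b. mul 0 0 (f a) (f b)) = f x" if "x \<in> carrier (H \<alpha>)" for x
    using act_mul_sw[OF that one_closed one_closed] that by (simp add: f_def unit_left one_closed)
  have f_inv: "sw (H \<alpha>) x (\<lambda>a b. mul 0 0 (f a) (S 0 (f b))) = smult (H 0) (counit (H \<alpha>) x) one"
    if x: "x \<in> carrier (H \<alpha>)" for x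
  proof -
    have "smult (H 0) (counit (H \<alpha>) x) one = sw (H 0) (act \<alpha> 0 x one) (\<lambda>a b. mul 0 0 a (S 0 b))"
      using antipode_right_sw[OF f_closed[OF x]] x
      by (simp add: f_def counit_act one_closed counit_one)
    also have "\<dots> = sw (H \<alpha>) x (\<lambda>x1 x2. sw (H 0) one (\<lambda>y1 y2.
        mul 0 0 (act \<alpha> 0 x1 y1) (S 0 (act \<alpha> 0 x2 y2))))"
      by (rule sw_bilin_coalg_hom[OF coalg coalg coalg act_hom vs[of 0]])
        (rule lin refl | simp add: closed coalg x)+
    \<comment> \<open>Since 1 is group-like, the inner sum has the single term at
      \<open>y1 = y2 = one\<close>.\<close>
    also have "\<dots> = sw (H \<alpha>) x (\<lambda>a b. mul 0 0 (f a) (S 0 (f b)))"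
      unfolding f_def
      by (rule sw_cong[OF refl], rule sw_one[OF vs[of 0]]) (rule lin refl | simp add: closed coalg x)+
    finally show ?thesis ..
  qed
  have "f x = sw (H \<alpha>) x (\<lambda>a q. smult (H 0) (counit (H \<alpha>) q) (f a))"
    by (rule sw_counit_linmap(2)[OF coalg x vs f_lin, symmetric])
  also have "\<dots> = sw (H \<alpha>) x (\<lambda>a q. mul 0 0 (f a) (smult (H 0) (counit (H \<alpha>) q) one))"
    using scale[of _ 0 _ 0] by (simp add: f_closed one_closed unit_right)
  also have "\<dots> = sw (H \<alpha>) x (\<lambda>a q. sw (H \<alpha>) q (\<lambda>b c. mul 0 0 (f a) (mul 0 0 (f b) (S 0 (f c)))))"
    by (simp add: pull f_inv[symmetric] f_closed closed)
  also have "\<dots> = sw (H \<alpha>) x (\<lambda>p c. sw (H \<alpha>) p (\<lambda>a b. mul 0 0 (f a) (mul 0 0 (f b) (S 0 (f c)))))"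
    by (rule sw_coassoc[OF coalg x vs[of 0], symmetric])
      (rule lin' refl | simp add: closed coalg x f_closed)+
  also have "\<dots> = sw (H \<alpha>) x (\<lambda>p c. mul 0 0 (sw (H \<alpha>) p (\<lambda>a b. mul 0 0 (f a) (f b))) (S 0 (f c)))"
    using assoc[of _ 0 _ 0 _ 0] by (simp add: pull f_closed closed)
  also have "\<dots> = smult (H 0) (counit (H \<alpha>) x) one"
    by (simp add: f_idem f_inv[OF x])
  finally show ?thesis by (simp add: f_def)
qed

text \<open>The star square of 1 is 1, so acting by 1 is idempotent. As 1 is group-like, \<psi> at 1
  is a left inverse of this map; an injective idempotent map is the identity.\<close>

lemma unit_act:
  assumes y: "y \<in> carrier (H \<beta>)"
  shows "act 0 \<beta> one y = y"
proof -
  have psi: "psi 0 \<beta> one (act 0 \<beta> one z) = z" if z: "z \<in> carrier (H \<beta>)" for z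
  proof -
    have "z = sw (H 0) one (\<lambda>a b. psi 0 \<beta> a (act 0 \<beta> b z))"
      using psi_act(1)[OF one_closed z] by (simp add: counit_one vspaceD)
    also have "\<dots> = psi 0 \<beta> one (act 0 \<beta> one z)"
      by (rule sw_one[OF vs[of \<beta>]]) (rule lin refl | simp add: closed coalg z)+
    finally show ?thesis ..
  qed
  have "star 0 0 one one = sw (H 0) one (\<lambda>a b. mul 0 0 a (act 0 0 b one))"
    by (rule star_sw[OF one_closed one_closed])
  also have "\<dots> = mul 0 0 one (act 0 0 one one)"
    by (rule sw_one[OF vs[of 0]]) (rule lin refl | simp add: closed coalg)+
  also have "\<dots> = one" by (simp add: act_unit one_closed counit_one vspaceD unit_left)
  finally have "act 0 \<beta> one (act 0 \<beta> one y) = act 0 \<beta> one y"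
    using act_act_star[OF one_closed one_closed y, of 0] by simp
  then show ?thesis using psi[OF y] psi[of "act 0 \<beta> one y"] y one_closed bilinD(1)[OF act_bilin] by metis
qed

lemma unit_star: "y \<in> carrier (H \<beta>) \<Longrightarrow> star 0 \<beta> one y = y"
proof -
  assume y: "y \<in> carrier (H \<beta>)"
  have "star 0 \<beta> one y = sw (H 0) one (\<lambda>a b. mul 0 \<beta> a (act 0 \<beta> b y))"
    by (rule star_sw[OF one_closed y])
  also have "\<dots> = mul 0 \<beta> one (act 0 \<beta> one y)"
    by (rule sw_one[OF vs[of \<beta>]]) (rule lin refl | simp add: closed coalg y)+
  finally show ?thesis using y by (simp add: unit_act unit_left)
qed

lemma star_unit:
  assumes x: "x \<in> carrier (H \<alpha>)"
  shows "star \<alpha> 0 x one = x"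
  using sw_counit(2)[OF coalg x] x scale(2)[of _ \<alpha> _ 0]
  by (simp add: star_sw one_closed act_unit unit_right)

section \<open>The star product as a coalgebra map, and its associativity\<close>

lemma comult_star:
  assumes x: "x \<in> carrier (H \<alpha>)" and y: "y \<in> carrier (H \<beta>)"
  shows "comult (H (\<alpha> + \<beta>)) (star \<alpha> \<beta> x y) =
    sw (H \<alpha>) x (\<lambda>x1 x2. sw (H \<beta>) y (\<lambda>y1 y2.
      pure (H (\<alpha> + \<beta>)) (H (\<alpha> + \<beta>)) (star \<alpha> \<beta> x1 y1) (star \<alpha> \<beta> x2 y2)))"
proof -
  let ?E = "H (\<alpha> + \<beta>)"
  let ?p = "pure ?E ?E"
  have W: "vspace (tensor ?E ?E)" by (rule vspace_tensor[OF vs])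
  note lin' = lin linmap_bilin_left[OF bilin_pure[of ?E ?E]] linmap_bilin_right[OF bilin_pure[of ?E ?E]]
  have "comult ?E (star \<alpha> \<beta> x y) = comult ?E (sw (H \<alpha>) x (\<lambda>p q. mul \<alpha> \<beta> p (act \<alpha> \<beta> q y)))"
    by (simp add: star_sw x y)
  also have "\<dots> = sw (H \<alpha>) x (\<lambda>p q. comult ?E (mul \<alpha> \<beta> p (act \<alpha> \<beta> q y)))"
    by (rule linmap_sw_outside[OF vs coalgebraD(2)[OF coalg]]) (simp add: closed y)
  also have "\<dots> = sw (H \<alpha>) x (\<lambda>p q. sw (H \<alpha>) p (\<lambda>a b. sw (H \<beta>) (act \<alpha> \<beta> q y)
      (\<lambda>u v. ?p (mul \<alpha> \<beta> a u) (mul \<alpha> \<beta> b v))))"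
    by (simp add: bilin_coalg_homD(2)[OF coalg coalg coalg mul_hom] closed y)
  also have "\<dots> = sw (H \<alpha>) x (\<lambda>p q. sw (H \<alpha>) p (\<lambda>a b. sw (H \<alpha>) q (\<lambda>c d. sw (H \<beta>) y (\<lambda>y1 y2.
      ?p (mul \<alpha> \<beta> a (act \<alpha> \<beta> c y1)) (mul \<alpha> \<beta> b (act \<alpha> \<beta> d y2))))))"
    by (rule sw_cong[OF refl], rule sw_cong[OF refl],
        rule sw_bilin_coalg_hom[OF coalg coalg coalg act_hom W])
      (rule lin' refl | simp add: closed coalg y)+
  \<comment> \<open>After the exchange \<open>p\<close> supplies both components in the left tensor
    factor and \<open>q\<close> both in the right one, so that each factor can be folded into a star
    product.\<close>
  also have "\<dots> = sw (H \<alpha>) x (\<lambda>p q. sw (H \<alpha>) p (\<lambda>a c. sw (H \<alpha>) q (\<lambda>b d. sw (H \<beta>) y (\<lambda>y1 y2.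
      ?p (mul \<alpha> \<beta> a (act \<alpha> \<beta> c y1)) (mul \<alpha> \<beta> b (act \<alpha> \<beta> d y2))))))"
    by (rule sw_interchange[OF coalg x cocomm W]) (rule lin' refl | simp add: closed coalg x y W)+
  also have "\<dots> = sw (H \<alpha>) x (\<lambda>p q. sw (H \<alpha>) p (\<lambda>a c. sw (H \<beta>) y (\<lambda>y1 y2. sw (H \<alpha>) q (\<lambda>b d.
      ?p (mul \<alpha> \<beta> a (act \<alpha> \<beta> c y1)) (mul \<alpha> \<beta> b (act \<alpha> \<beta> d y2))))))"
    by (rule sw_cong[OF refl], rule sw_cong[OF refl], rule sw_swap)
  also have "\<dots> = sw (H \<alpha>) x (\<lambda>p q. sw (H \<beta>) y (\<lambda>y1 y2. sw (H \<alpha>) p (\<lambda>a c. sw (H \<alpha>) q (\<lambda>b d.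
      ?p (mul \<alpha> \<beta> a (act \<alpha> \<beta> c y1)) (mul \<alpha> \<beta> b (act \<alpha> \<beta> d y2))))))"
    by (rule sw_cong[OF refl], rule sw_swap)
  also have "\<dots> = sw (H \<alpha>) x (\<lambda>x1 x2. sw (H \<beta>) y (\<lambda>y1 y2. ?p (star \<alpha> \<beta> x1 y1) (star \<alpha> \<beta> x2 y2)))"
    by (simp add: star_sw closed bilin_sw_left[OF bilin_pure[of ?E ?E] vs])
      (simp add: closed bilin_sw_right[OF bilin_pure[of ?E ?E] vs])
  finally show ?thesis .
qed

lemma counit_star:
  assumes x: "x \<in> carrier (H \<alpha>)" and y: "y \<in> carrier (H \<beta>)"
  shows "counit (H (\<alpha> + \<beta>)) (star \<alpha> \<beta> x y) = counit (H \<alpha>) x * counit (H \<beta>) y"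
proof -
  have "counit (H (\<alpha> + \<beta>)) (star \<alpha> \<beta> x y) =
      sw (H \<alpha>) x (\<lambda>p q. counit (H (\<alpha> + \<beta>)) (mul \<alpha> \<beta> p (act \<alpha> \<beta> q y)))"
    unfolding star_sw[OF x y]
    by (rule linmap_sw_outside[OF vs coalgebraD(3)[OF coalg]]) (simp add: closed y)
  \<comment> \<open>The product in the field is written with \<open>smult base\<close>, so that the
    counit law for linear maps applies with target \<open>base\<close>.\<close>
  also have "\<dots> = sw (H \<alpha>) x (\<lambda>p q. smult base (counit (H \<alpha>) p) (counit (H \<alpha>) q * counit (H \<beta>) y))"
    by (simp add: counit_mul counit_act closed y base_def)
  also have "\<dots> = counit (H \<alpha>) x * counit (H \<beta>) y"
    using coalgebraD(3)[OF coalg[of \<alpha>]]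
    by (intro sw_counit_linmap(1)[OF coalg x vspace_base])
      (simp add: linmap_def base_def algebra_simps)
  finally show ?thesis .
qed

lemma star_hom: "bilin_coalg_hom (H \<alpha>) (H \<beta>) (H (\<alpha> + \<beta>)) (star \<alpha> \<beta>)"
  by (intro bilin_coalg_homI coalg star_bilin refl comult_star counit_star)

lemma star_closed: "x \<in> carrier (H \<alpha>) \<Longrightarrow> y \<in> carrier (H \<beta>) \<Longrightarrow> \<gamma> = \<alpha> + \<beta> \<Longrightarrow>
    star \<alpha> \<beta> x y \<in> carrier (H \<gamma>)"
  using bilinD(1)[OF star_bilin] by simp

text \<open>Both sides expand to a sum of a ((b \<triangleright> y1) (c \<triangleright> (y2
  \<triangleright> z))). On the left the star product is split as a coalgebra map and its action by
  \<open>act_act_star\<close>; on the right the action is distributed over \<open>mul\<close>.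
  Coassociativity in \<open>x\<close> reconciles the two bracketings.\<close>

lemma star_assoc:
  assumes x: "x \<in> carrier (H \<alpha>)" and y: "y \<in> carrier (H \<beta>)" and z: "z \<in> carrier (H \<gamma>)"
  shows "star (\<alpha> + \<beta>) \<gamma> (star \<alpha> \<beta> x y) z = star \<alpha> (\<beta> + \<gamma>) x (star \<beta> \<gamma> y z)"
proof -
  let ?\<delta> = "\<alpha> + \<beta> + \<gamma>"
  let ?f = "\<lambda>a b c y1 y2. mul \<alpha> (\<beta> + \<gamma>) a (mul \<beta> \<gamma> (act \<alpha> \<beta> b y1) (act \<alpha> \<gamma> c (act \<beta> \<gamma> y2 z)))"
  have "star (\<alpha> + \<beta>) \<gamma> (star \<alpha> \<beta> x y) z =
      sw (H (\<alpha> + \<beta>)) (star \<alpha> \<beta> x y) (\<lambda>p q. mul (\<alpha> + \<beta>) \<gamma> p (act (\<alpha> + \<beta>) \<gamma> q z))"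
    by (rule star_sw[OF star_closed[OF x y refl] z])
  also have "\<dots> = sw (H \<alpha>) x (\<lambda>x1 x2. sw (H \<beta>) y (\<lambda>y1 y2.
      mul (\<alpha> + \<beta>) \<gamma> (star \<alpha> \<beta> x1 y1) (act (\<alpha> + \<beta>) \<gamma> (star \<alpha> \<beta> x2 y2) z)))"
    by (rule sw_bilin_coalg_hom[OF coalg coalg coalg star_hom vs[of ?\<delta>]])
      (rule lin refl | simp add: closed coalg x y z)+
  also have "\<dots> = sw (H \<alpha>) x (\<lambda>p c. sw (H \<beta>) y (\<lambda>y1 y2. sw (H \<alpha>) p (\<lambda>a b. ?f a b c y1 y2)))"
    by (simp add: act_act_star z) (simp add: star_sw pull assoc closed z)
  also have "\<dots> = sw (H \<alpha>) x (\<lambda>p c. sw (H \<alpha>) p (\<lambda>a b. sw (H \<beta>) y (\<lambda>y1 y2. ?f a b c y1 y2)))"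
    by (rule sw_cong[OF refl], rule sw_swap)
  also have "\<dots> = sw (H \<alpha>) x (\<lambda>a q. sw (H \<alpha>) q (\<lambda>b c. sw (H \<beta>) y (\<lambda>y1 y2. ?f a b c y1 y2)))"
    by (rule sw_coassoc[OF coalg x vs[of ?\<delta>]])
      (rule lin refl | simp add: closed coalg y z add.assoc)+
  also have "\<dots> = sw (H \<alpha>) x (\<lambda>a q. sw (H \<beta>) y (\<lambda>y1 y2. sw (H \<alpha>) q (\<lambda>b c. ?f a b c y1 y2)))"
    by (rule sw_cong[OF refl], rule sw_swap)
  also have "\<dots> = star \<alpha> (\<beta> + \<gamma>) x (star \<beta> \<gamma> y z)"
    by (simp add: star_sw x y z closed) (simp add: pull act_mul_sw closed z y)
  finally show ?thesis .
qed

text \<open>The convolution inverse of \<open>c \<mapsto> (z \<mapsto> c * z)\<close>.\<close>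

definition star_inv :: "'a \<Rightarrow> 'a \<Rightarrow> 'c \<Rightarrow> 'c \<Rightarrow> 'c" where
  "star_inv \<alpha> \<delta> c v = sw (H \<alpha>) c (\<lambda>c1 c2. psi \<alpha> \<delta> c1 (mul (- \<alpha>) (\<alpha> + \<delta>) (S \<alpha> c2) v))"

text \<open>The parameter \<open>\<delta>\<close> is the degree of the value; the argument has
  degree \<open>\<alpha> + \<delta>\<close>, since the map undoes a shift by
  \<open>\<alpha>\<close>.\<close>

lemma star_inv_bilin: "\<gamma> = \<alpha> + \<delta> \<Longrightarrow> bilin (H \<alpha>) (H \<gamma>) (H \<delta>) (star_inv \<alpha> \<delta>)"
  unfolding star_inv_def by (rule lin refl | simp add: closed coalg)+

section \<open>The antipode of the star product and its two laws\<close>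

lemma antipode_eq_star_inv:
  assumes "c \<in> carrier (H \<alpha>)"
  shows "T \<alpha> c = star_inv \<alpha> (- \<alpha>) c one"
proof -
  have "T \<alpha> c = sw (H \<alpha>) c (\<lambda>c1 c2. psi \<alpha> (- \<alpha>) c1 (S \<alpha> c2))"
    unfolding star_antipode_def
    by (rule sweedler_eq_sw[of _ "H (- \<alpha>)"]) (rule lin refl | simp add: closed coalg assms)+
  also have "\<dots> = star_inv \<alpha> (- \<alpha>) c one"
    unfolding star_inv_def by (simp add: unit_right closed)
  finally show ?thesis .
qed

lemma T_linear: "\<beta> = - \<alpha> \<Longrightarrow> linmap (H \<alpha>) (H \<beta>) (T \<alpha>)"
proof -
  assume \<beta>: "\<beta> = - \<alpha>"
  have "linmap (H \<alpha>) (H \<beta>) (\<lambda>c. star_inv \<alpha> (- \<alpha>) c one)" unfolding \<beta>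
    by (rule linmap_bilin_left[OF star_inv_bilin linmap_id one_closed]) simp
  then show ?thesis using antipode_eq_star_inv by (simp add: linmap_cong[OF vs, where f = "T \<alpha>"])
qed

lemma T_closed: "c \<in> carrier (H \<alpha>) \<Longrightarrow> \<beta> = - \<alpha> \<Longrightarrow> T \<alpha> c \<in> carrier (H \<beta>)"
  using linmapD(1)[OF T_linear] .

lemmas closed' = closed star_closed T_closed bilinD(1)[OF star_inv_bilin]

lemmas lin' = lin linmap_compose[OF T_linear]
  linmap_bilin_left[OF star_bilin] linmap_bilin_right[OF star_bilin]
  linmap_bilin_left[OF star_inv_bilin] linmap_bilin_right[OF star_inv_bilin]

text \<open>The components occur as \<psi> at a, S b, d, e. Coassociativity collects the neighbours
  b and d into one coproduct, where the left antipode law of \<open>mul\<close> cancels them; what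
  remains is \<psi> against the action.\<close>

lemma star_inv_star:
  assumes c: "c \<in> carrier (H \<alpha>)" and z: "z \<in> carrier (H \<delta>)"
  shows "sw (H \<alpha>) c (\<lambda>p q. star_inv \<alpha> \<delta> p (star \<alpha> \<delta> q z)) = smult (H \<delta>) (counit (H \<alpha>) c) z"
proof -
  let ?f = "\<lambda>a b d e. psi \<alpha> \<delta> a (mul 0 \<delta> (mul (- \<alpha>) \<alpha> (S \<alpha> b) d) (act \<alpha> \<delta> e z))"
  have assoc': "mul (- \<alpha>) (\<alpha> + \<delta>) (S \<alpha> b) (mul \<alpha> \<delta> d w) = mul 0 \<delta> (mul (- \<alpha>) \<alpha> (S \<alpha> b) d) w"
    if "b \<in> carrier (H \<alpha>)" "d \<in> carrier (H \<alpha>)" "w \<in> carrier (H \<delta>)" for b d w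
    using assoc[of "S \<alpha> b" "- \<alpha>" d \<alpha> w \<delta>] that by (simp add: closed)
  have "sw (H \<alpha>) c (\<lambda>p q. star_inv \<alpha> \<delta> p (star \<alpha> \<delta> q z)) =
      sw (H \<alpha>) c (\<lambda>p q. sw (H \<alpha>) p (\<lambda>a b. sw (H \<alpha>) q (\<lambda>d e. ?f a b d e)))"
    by (simp add: star_inv_def star_sw z) (simp add: pull assoc' closed z)
  also have "\<dots> = sw (H \<alpha>) c (\<lambda>a r. sw (H \<alpha>) r (\<lambda>b q. sw (H \<alpha>) q (\<lambda>d e. ?f a b d e)))"
    by (rule sw_coassoc[OF coalg c vs[of \<delta>]]) (rule lin refl | simp add: closed coalg z)+
  also have "\<dots> = sw (H \<alpha>) c (\<lambda>a r. sw (H \<alpha>) r (\<lambda>m e. sw (H \<alpha>) m (\<lambda>b d. ?f a b d e)))"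
    by (rule sw_cong[OF refl], rule sw_coassoc[OF coalg _ vs[of \<delta>], symmetric])
      (rule lin refl | simp add: closed coalg z)+
  also have "\<dots> = sw (H \<alpha>) c (\<lambda>a r. sw (H \<alpha>) r (\<lambda>m e.
      psi \<alpha> \<delta> a (mul 0 \<delta> (sw (H \<alpha>) m (\<lambda>b d. mul (- \<alpha>) \<alpha> (S \<alpha> b) d)) (act \<alpha> \<delta> e z))))"
    by (simp add: pull closed z)
  also have "\<dots> = sw (H \<alpha>) c (\<lambda>a r. sw (H \<alpha>) r (\<lambda>m e.
      smult (H \<delta>) (counit (H \<alpha>) m) (psi \<alpha> \<delta> a (act \<alpha> \<delta> e z))))"
    using scale(1)[of _ 0 _ \<delta>] by (simp add: antipode_left_sw scale closed z unit_left)
  also have "\<dots> = sw (H \<alpha>) c (\<lambda>a r. psi \<alpha> \<delta> a (act \<alpha> \<delta> r z))"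
    by (rule sw_cong[OF refl], rule sw_counit_linmap(1)[OF coalg _ vs[of \<delta>]])
      (rule lin refl | simp add: closed coalg z)+
  also have "\<dots> = smult (H \<delta>) (counit (H \<alpha>) c) z" by (rule psi_act(1)[OF c z])
  finally show ?thesis .
qed

text \<open>Cancellation now runs in the opposite order: the middle pair is the action against
  \<psi>, and the outer pair is left to the right antipode law of \<open>mul\<close>. Indexing by
  the degree \<gamma> of \<open>w\<close> makes \<gamma> = 0, \<open>w = one\<close> the case of the
  antipode.\<close>

lemma star_star_inv:
  assumes c: "c \<in> carrier (H \<alpha>)" and w: "w \<in> carrier (H \<gamma>)"
  shows "sw (H \<alpha>) c (\<lambda>p q. star \<alpha> (\<gamma> - \<alpha>) p (star_inv \<alpha> (\<gamma> - \<alpha>) q w)) = smult (H \<gamma>) (counit (H \<alpha>) c) w"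
proof -
  let ?X = "\<lambda>e. mul (- \<alpha>) \<gamma> (S \<alpha> e) w"
  let ?f = "\<lambda>a b d e. mul \<alpha> (\<gamma> - \<alpha>) a (act \<alpha> (\<gamma> - \<alpha>) b (psi \<alpha> (\<gamma> - \<alpha>) d (?X e)))"
  have X: "?X e \<in> carrier (H (\<gamma> - \<alpha>))" if "e \<in> carrier (H \<alpha>)" for e
    using that w by (simp add: closed)
  have assoc': "mul \<alpha> (\<gamma> - \<alpha>) a (?X e) = mul 0 \<gamma> (mul \<alpha> (- \<alpha>) a (S \<alpha> e)) w"
    if "a \<in> carrier (H \<alpha>)" "e \<in> carrier (H \<alpha>)" for a e
    using assoc[of a \<alpha> "S \<alpha> e" "- \<alpha>" w \<gamma>] that w by (simp add: closed)
  have "sw (H \<alpha>) c (\<lambda>p q. star \<alpha> (\<gamma> - \<alpha>) p (star_inv \<alpha> (\<gamma> - \<alpha>) q w)) =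
      sw (H \<alpha>) c (\<lambda>p q. sw (H \<alpha>) p (\<lambda>a b. sw (H \<alpha>) q (\<lambda>d e. ?f a b d e)))"
    by (simp add: star_inv_def star_sw closed X) (simp add: pull closed X)
  also have "\<dots> = sw (H \<alpha>) c (\<lambda>a r. sw (H \<alpha>) r (\<lambda>b q. sw (H \<alpha>) q (\<lambda>d e. ?f a b d e)))"
    by (rule sw_coassoc[OF coalg c vs[of \<gamma>]]) (rule lin refl | simp add: closed coalg X w)+
  also have "\<dots> = sw (H \<alpha>) c (\<lambda>a r. sw (H \<alpha>) r (\<lambda>m e. sw (H \<alpha>) m (\<lambda>b d. ?f a b d e)))"
    by (rule sw_cong[OF refl], rule sw_coassoc[OF coalg _ vs[of \<gamma>], symmetric])
      (rule lin refl | simp add: closed coalg X w)+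
  also have "\<dots> = sw (H \<alpha>) c (\<lambda>a r. sw (H \<alpha>) r (\<lambda>m e.
      mul \<alpha> (\<gamma> - \<alpha>) a (sw (H \<alpha>) m (\<lambda>b d. act \<alpha> (\<gamma> - \<alpha>) b (psi \<alpha> (\<gamma> - \<alpha>) d (?X e))))))"
    by (simp add: pull closed X)
  also have "\<dots> = sw (H \<alpha>) c (\<lambda>a r. sw (H \<alpha>) r (\<lambda>m e.
      smult (H \<gamma>) (counit (H \<alpha>) m) (mul \<alpha> (\<gamma> - \<alpha>) a (?X e))))"
    by (simp add: psi_act(2) scale closed X)
  also have "\<dots> = sw (H \<alpha>) c (\<lambda>a r. mul \<alpha> (\<gamma> - \<alpha>) a (?X r))"
    by (rule sw_cong[OF refl], rule sw_counit_linmap(1)[OF coalg _ vs[of \<gamma>]])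
      (rule lin refl | simp add: closed coalg X w)+
  also have "\<dots> = mul 0 \<gamma> (sw (H \<alpha>) c (\<lambda>a r. mul \<alpha> (- \<alpha>) a (S \<alpha> r))) w"
    by (simp add: assoc' pull closed w)
  also have "\<dots> = smult (H \<gamma>) (counit (H \<alpha>) c) w"
    using scale(1)[of _ 0 _ \<gamma>] by (simp add: antipode_right_sw c w one_closed unit_left)
  finally show ?thesis .
qed

lemma star_antipode_right:
  assumes c: "c \<in> carrier (H \<alpha>)"
  shows "sw (H \<alpha>) c (\<lambda>p q. star \<alpha> (- \<alpha>) p (T \<alpha> q)) = smult (H 0) (counit (H \<alpha>) c) one"
  using star_star_inv[OF c one_closed] by (simp add: antipode_eq_star_inv)

text \<open>A left and a right convolution inverse of left star multiplication must agree:
  \<open>star_inv\<close> is a left inverse, and associativity with the right antipode law makes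
  star multiplication by \<open>T\<close> a right inverse. The calculation is this uniqueness
  argument with degrees written out.\<close>

lemma star_antipode_star:
  assumes c: "c \<in> carrier (H \<alpha>)" and v: "v \<in> carrier (H \<gamma>)"
  shows "star (- \<alpha>) \<gamma> (T \<alpha> c) v = star_inv \<alpha> (\<gamma> - \<alpha>) c v"
proof -
  let ?g = "\<lambda>q. star (- \<alpha>) \<gamma> (T \<alpha> q) v"
  have g: "linmap (H \<alpha>) (H (\<gamma> - \<alpha>)) ?g"
    by (rule lin' refl | simp add: closed' v)+
  have gc: "?g q \<in> carrier (H (\<gamma> - \<alpha>))" if "q \<in> carrier (H \<alpha>)" for q using linmapD(1)[OF g that] .
  have assoc': "star \<alpha> (\<gamma> - \<alpha>) b (?g q) = star 0 \<gamma> (star \<alpha> (- \<alpha>) b (T \<alpha> q)) v"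
    if "b \<in> carrier (H \<alpha>)" "q \<in> carrier (H \<alpha>)" for b q
    using star_assoc[of b \<alpha> "T \<alpha> q" "- \<alpha>" v \<gamma>] that v by (simp add: closed')
  have "?g c = sw (H \<alpha>) c (\<lambda>p q. smult (H (\<gamma> - \<alpha>)) (counit (H \<alpha>) p) (?g q))"
    by (rule sw_counit_linmap(1)[OF coalg c vs g, symmetric])
  also have "\<dots> = sw (H \<alpha>) c (\<lambda>p q. sw (H \<alpha>) p (\<lambda>a b. star_inv \<alpha> (\<gamma> - \<alpha>) a (star \<alpha> (\<gamma> - \<alpha>) b (?g q))))"
    by (simp add: star_inv_star gc)
  also have "\<dots> = sw (H \<alpha>) c (\<lambda>a r. sw (H \<alpha>) r (\<lambda>b q. star_inv \<alpha> (\<gamma> - \<alpha>) a (star \<alpha> (\<gamma> - \<alpha>) b (?g q))))"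
    by (rule sw_coassoc[OF coalg c vs[of "\<gamma> - \<alpha>"]])
      (rule g lin' refl | simp add: closed' gc)+
  \<comment> \<open>Associativity separates \<open>v\<close> from the product of \<open>b\<close>
    with \<open>T q\<close>, so that the right antipode law applies to the inner sum.\<close>
  also have "\<dots> = sw (H \<alpha>) c (\<lambda>a r. star_inv \<alpha> (\<gamma> - \<alpha>) a
      (star 0 \<gamma> (sw (H \<alpha>) r (\<lambda>b q. star \<alpha> (- \<alpha>) b (T \<alpha> q))) v))"
    by (simp add: assoc' bilin_sw_left[OF star_bilin[OF refl] vs]
        bilin_sw_right[OF star_inv_bilin[OF refl] vs] closed' v)
  also have "\<dots> = sw (H \<alpha>) c (\<lambda>a r. smult (H (\<gamma> - \<alpha>)) (counit (H \<alpha>) r) (star_inv \<alpha> (\<gamma> - \<alpha>) a v))"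
    using bilinD(4)[OF star_bilin[OF refl], of _ 0 _ \<gamma>]
    by (simp add: star_antipode_right unit_star one_closed v
        bilinD(5)[OF star_inv_bilin[of \<gamma> \<alpha> "\<gamma> - \<alpha>"]])
  also have "\<dots> = star_inv \<alpha> (\<gamma> - \<alpha>) c v"
    by (rule sw_counit_linmap(2)[OF coalg c vs[of "\<gamma> - \<alpha>"]])
      (rule lin' refl | simp add: closed' v)+
  finally show ?thesis .
qed

lemma star_antipode_left:
  assumes c: "c \<in> carrier (H \<alpha>)"
  shows "sw (H \<alpha>) c (\<lambda>p q. star (- \<alpha>) \<alpha> (T \<alpha> p) q) = smult (H 0) (counit (H \<alpha>) c) one"
  \<comment> \<open>With \<gamma> = \<alpha> the target degree is \<alpha> - \<alpha> = 0, and the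
    second component \<open>q\<close> is read as \<open>q\<close> star 1.\<close>
  using star_inv_star[OF c one_closed] by (simp add: star_antipode_star[of _ \<alpha> _ \<alpha>, simplified] star_unit)

section \<open>The Hopf structure and the modulelike bialgebra\<close>

lemma hopf_pi_algebra_star: "hopf_pi_algebra H star one T"
proof
  fix \<alpha> x assume x: "x \<in> carrier (H \<alpha>)"
  have "sweedler (H \<alpha>) x (\<lambda>x1 x2. star (- \<alpha>) \<alpha> (T \<alpha> x1) x2) =
      sw (H \<alpha>) x (\<lambda>x1 x2. star (- \<alpha>) \<alpha> (T \<alpha> x1) x2)"
    by (rule sweedler_eq_sw[of _ "H 0"]) (rule lin' refl | simp add: closed' coalg x)+
  then show "sweedler (H \<alpha>) x (\<lambda>x1 x2. star (- \<alpha>) \<alpha> (T \<alpha> x1) x2) =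
      smult (H 0) (counit (H \<alpha>) x) one" by (simp add: star_antipode_left x)
  have "sweedler (H \<alpha>) x (\<lambda>x1 x2. star \<alpha> (- \<alpha>) x1 (T \<alpha> x2)) =
      sw (H \<alpha>) x (\<lambda>x1 x2. star \<alpha> (- \<alpha>) x1 (T \<alpha> x2))"
    by (rule sweedler_eq_sw[of _ "H 0"]) (rule lin' refl | simp add: closed' coalg x)+
  then show "sweedler (H \<alpha>) x (\<lambda>x1 x2. star \<alpha> (- \<alpha>) x1 (T \<alpha> x2)) =
      smult (H 0) (counit (H \<alpha>) x) one" by (simp add: star_antipode_right x)
qed (simp_all add: coalg star_hom one_closed unit_hom star_assoc unit_star star_unit T_linear)

lemma hopf_algebra_zero: "hopf_algebra (H 0) (mul 0 0) one (S 0)"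
  using mul_hom[of 0 0] assoc[of _ 0 _ 0 _ 0] antipode_linear[of 0] antipode_left[of _ 0]
    antipode_right[of _ 0]
  by unfold_locales (simp_all add: coalg one_closed unit_hom unit_left unit_right)

text \<open>The product and module axioms are the two post-Hopf axioms with acted-on degree e, the
  coproduct and counit axioms say that the action is a coalgebra map, and the two axioms on units
  are \<open>act_unit\<close> and \<open>unit_act\<close>.\<close>

lemma modulelike_bialgebra_star:
  "modulelike_bialgebra H star one T (H 0) (mul 0 0) one (S 0) (\<lambda>\<alpha>. act \<alpha> 0)"
proof -
  interpret K: hopf_pi_algebra H star one T by (rule hopf_pi_algebra_star)
  interpret A: hopf_algebra "H 0" "mul 0 0" one "S 0" by (rule hopf_algebra_zero)
  show ?thesis
  proof
    show "bilin (H \<alpha>) (H 0) (H 0) (act \<alpha> 0)" for \<alpha> by (rule act_bilin)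
    show "act (\<alpha> + \<beta>) 0 (star \<alpha> \<beta> k l) a = act \<alpha> 0 k (act \<beta> 0 l a)"
      if "k \<in> carrier (H \<alpha>)" "l \<in> carrier (H \<beta>)" "a \<in> carrier (H 0)" for k l a \<alpha> \<beta>
      by (rule act_act_star[OF that refl])
    show "act 0 0 one a = a" if "a \<in> carrier (H 0)" for a by (rule unit_act[OF that])
    show "act \<alpha> 0 k (mul 0 0 a b) =
        sweedler (H \<alpha>) k (\<lambda>k1 k2. mul 0 0 (act \<alpha> 0 k1 a) (act \<alpha> 0 k2 b))"
      if "k \<in> carrier (H \<alpha>)" "a \<in> carrier (H 0)" "b \<in> carrier (H 0)" for k a b \<alpha>
      using act_mul[OF that] by simp
    show "act \<alpha> 0 k one = smult (H 0) (counit (H \<alpha>) k) one" if "k \<in> carrier (H \<alpha>)" for k \<alpha>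
      by (rule act_unit[OF that])
    show "comult (H 0) (act \<alpha> 0 k a) = sweedler (H \<alpha>) k (\<lambda>k1 k2. sweedler (H 0) a (\<lambda>a1 a2.
        pure (H 0) (H 0) (act \<alpha> 0 k1 a1) (act \<alpha> 0 k2 a2)))"
      if "k \<in> carrier (H \<alpha>)" "a \<in> carrier (H 0)" for k a \<alpha>
      unfolding bilin_coalg_homD(2)[OF coalg coalg coalg act_hom that]
      by (rule sweedler_sweedler_eq_sw[OF coalg that(1) coalg that(2) vspace_tensor[OF vs]
          act_bilin act_bilin bilin_pure, symmetric])
    show "counit (H 0) (act \<alpha> 0 k a) = counit (H \<alpha>) k * counit (H 0) a"
      if "k \<in> carrier (H \<alpha>)" "a \<in> carrier (H 0)" for k a \<alpha>
      by (rule counit_act[OF that])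
  qed
qed

end

theorem theorem3p4:
  fixes H :: "'p::ab_group_add \<Rightarrow> ('k::field, 'v::ab_group_add) coalg"
    and mul act :: "'p \<Rightarrow> 'p \<Rightarrow> 'v \<Rightarrow> 'v \<Rightarrow> 'v"
    and one :: 'v
    and S :: "'p \<Rightarrow> 'v \<Rightarrow> 'v"
  assumes "post_hopf_pi_algebra H mul one S act"
    and "\<And>\<alpha>. cocommutative (H \<alpha>)"
  shows "hopf_pi_algebra H (star_mul H mul act) one (star_antipode H S act) \<and>
         modulelike_bialgebra
           H (star_mul H mul act) one (star_antipode H S act)
           (H 0) (mul 0 0) one (S 0) (\<lambda>\<alpha>. act \<alpha> 0)"
proof -
  interpret cocommutative_post_hopf_pi_algebra H mul one S act
    using assms by (intro cocommutative_post_hopf_pi_algebra.intro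
        cocommutative_post_hopf_pi_algebra_axioms.intro)
  show ?thesis using hopf_pi_algebra_star modulelike_bialgebra_star by blast
qed

end
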